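(* The derivative $g_3'(\tau)$ has a unique zero $\tau_\infty$ in $F_0$, and $\tau_\infty=\frac12+ib_\infty$ with $b_\infty\in(\frac12,\frac{\sqrt3}{2})$. Consequently, for every $m\in\mathbb Z$, $\tau_\infty+m$ is the unique zero of $g_3'$ in $F_0+m$.
   Context: $\mathbb H$ is the upper half-plane; $g_3(\tau)=140\sum_{(m,n)\in\mathbb Z^2\setminus\{(0,0)\}}(m\tau+n)^{-6}$ for $\tau\in\mathbb H$. $F_0=\{\tau\in\mathbb H:0\le\operatorname{Re}\tau\le1,\ |\tau-\frac12|\ge\frac12\}$. *)

theory Defs
  imports "HOL-Complex_Analysis.Complex_Analysis"
begin

text \<open>Meaningful for \<open>Im \<tau> > 0\<close>, where the double series converges absolutely, so that the
  unordered sum is the classical value.\<close>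

definition g3 :: "complex \<Rightarrow> complex" where
  "g3 \<tau> = 140 * (\<Sum>\<^sub>\<infinity>(m, n) \<in> (UNIV :: (int \<times> int) set) - {(0, 0)}.
              1 / (of_int m * \<tau> + of_int n) ^ 6)"

definition upper_half_plane :: "complex set" where
  "upper_half_plane = {\<tau>. Im \<tau> > 0}"

definition F0 :: "complex set" where
  "F0 = {\<tau> \<in> upper_half_plane. 0 \<le> Re \<tau> \<and> Re \<tau> \<le> 1 \<and> cmod (\<tau> - 1/2) \<ge> 1/2}"

end

theory Submission
  imports Defs
begin

text \<open>Put \<open>q = exp (2 \<pi> i \<tau>)\<close>. The order 3 map \<open>\<tau> \<mapsto> 1 - 1/\<tau>\<close> permutes the cusps of the ideal triangle
  \<open>F0\<close>, so up to this rotation and the reflection \<open>\<tau> \<mapsto> 1 - cnj \<tau>\<close> a zero of \<open>g3'\<close> is represented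
  by a point of the triangle \<open>0 \<le> Re \<tau> \<le> 1, \<bar>\<tau>\<bar> \<ge> 1, \<bar>\<tau> - 1\<bar> \<ge> 1\<close>, where \<open>\<bar>q\<bar> \<le> exp (- \<pi> \<surd>3) < 1/230\<close>
  and the \<open>q\<close>-expansion of \<open>g3\<close> is dominated by its first terms. There \<open>g3'\<close> itself has no zero,
  while a zero of \<open>g3'\<close> at \<open>1 - 1/\<tau>\<close> means \<open>6 g3 \<tau> + \<tau> g3' \<tau> = 0\<close>. Divided by its factor \<open>q\<close>, the
  latter is \<open>1/q\<close> plus a slowly varying function; all its zeros lie in the strip
  \<open>Im \<tau> \<ge> 47/50, 5/8 \<le> Re \<tau> \<le> 7/8\<close>, where its derivative has positive real part, so there is at most
  one. On the line \<open>Re \<tau> = 1/2\<close> the function \<open>g3\<close> is real, vanishes at \<open>(1 + i)/2\<close>, and is positive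
  and decreasing in \<open>Im \<tau>\<close> at \<open>exp (\<pi> i / 3)\<close>, so its derivative has a zero in between.\<close>

subsection \<open>Lipschitz formula\<close>

definition nome :: "complex \<Rightarrow> complex" where
  "nome \<tau> = exp (2 * of_real pi * \<i> * \<tau>)"

lemma norm_nome: "norm (nome \<tau>) = exp (- (2 * pi * Im \<tau>))"
  by (simp add: nome_def)

lemma norm_nome_less_one: "Im \<tau> > 0 \<Longrightarrow> norm (nome \<tau>) < 1"
  by (simp add: norm_nome)

lemma nome_nonzero: "nome \<tau> \<noteq> 0"
  by (simp add: nome_def)

lemma nome_add_int: "nome (\<tau> + of_int m) = nome \<tau>"
proof -
  have "exp (2 * of_real pi * \<i> * of_int m) = (1 :: complex)"
    using exp_integer_2pi [of "of_int m"] by (simp add: mult_ac)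
  then show ?thesis
    by (simp add: nome_def distrib_left exp_add)
qed

lemma cnj_nome: "cnj (nome \<tau>) = nome (- cnj \<tau>)"
  by (simp add: nome_def exp_cnj)

lemma nome_has_field_derivative:
  "(nome has_field_derivative 2 * of_real pi * \<i> * nome \<tau>) (at \<tau>)"
  unfolding nome_def [abs_def] by (auto intro!: derivative_eq_intros)

section \<open>Power series in the nome\<close>

lemma summable_power_mult_geometric:
  fixes x :: "'a :: {real_normed_field, banach}"
  assumes "norm x < 1"
  shows "summable (\<lambda>n. of_nat n ^ k * x ^ n)"
  using assms
proof (induction k arbitrary: x)
  case 0
  then show ?case by (simp add: summable_geometric)
next
  case (Suc k)
  have "summable (\<lambda>n. diffs (\<lambda>n. of_nat n ^ k :: 'a) n * x ^ n)"
    using Suc.IH Suc.prems by (rule termdiff_converges[rotated]) 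
  then have "summable (\<lambda>n. x * (diffs (\<lambda>n. of_nat n ^ k :: 'a) n * x ^ n))"
    by (rule summable_mult)
  then have "summable (\<lambda>n. of_nat (Suc n) ^ Suc k * x ^ Suc n)"
    by (simp add: diffs_def algebra_simps)
  then show ?case
    by (subst (asm) summable_Suc_iff)
qed

text \<open>The summand \<open>D\<close> covers the index 0, where n^k vanishes for k > 0 although
  the coefficients of the shifted series further down do not.\<close>

lemma summable_norm_powser_poly_growth:
  fixes c :: "nat \<Rightarrow> 'a :: {real_normed_field, banach}"
  assumes "\<And>n. norm (c n) \<le> C * real n ^ k + D" and "norm x < 1"
  shows "summable (\<lambda>n. norm (c n * x ^ n))"
proof (rule summable_comparison_test')
  show "summable (\<lambda>n. C * (real n ^ k * norm x ^ n) + D * norm x ^ n)"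
    using assms(2) summable_power_mult_geometric [of "norm x" k]
    by (intro summable_add summable_mult summable_geometric) auto
  fix n
  have "norm (c n) * norm x ^ n \<le> (C * real n ^ k + D) * norm x ^ n"
    using assms(1) by (intro mult_right_mono) auto
  then show "norm (norm (c n * x ^ n)) \<le> C * (real n ^ k * norm x ^ n) + D * norm x ^ n"
    by (simp add: norm_mult norm_power algebra_simps)
qed

text \<open>With q = \<open>nome \<tau>\<close>, the chain rule turns d/d\<tau> into 2 pi i q d/dq,
  and q d/dq multiplies the n-th coefficient by n.\<close>

lemma powser_nome_has_field_derivative:
  fixes c :: "nat \<Rightarrow> complex"
  assumes "\<And>n. norm (c n) \<le> C * real n ^ k + D" and "Im \<tau> > 0"
  shows "((\<lambda>\<tau>. \<Sum>n. c n * nome \<tau> ^ n) has_field_derivative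
           2 * of_real pi * \<i> * (\<Sum>n. of_nat n * c n * nome \<tau> ^ n)) (at \<tau>)"
proof -
  let ?x = "nome \<tau>"
  have x: "norm ?x < 1"
    using assms by (simp add: norm_nome_less_one)
  have summ: "summable (\<lambda>n. c n * x ^ n)" if "norm x < 1" for x
    using summable_norm_powser_poly_growth [OF assms(1) that] by (rule summable_norm_cancel)
  have D: "((\<lambda>x. \<Sum>n. c n * x ^ n) has_field_derivative (\<Sum>n. diffs c n * ?x ^ n)) (at ?x)"
    using summ x by (rule termdiffs_strong')
  have "summable (\<lambda>n. diffs c n * ?x ^ n)"
    using x summ by (rule termdiff_converges)
  then have "(\<Sum>n. diffs c n * ?x ^ n) * ?x = (\<Sum>n. of_nat (Suc n) * c (Suc n) * ?x ^ Suc n)"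
    by (subst suminf_mult2) (simp_all add: diffs_def mult_ac)
  also have "\<dots> = (\<Sum>n. of_nat n * c n * ?x ^ n)"
  proof -
    have "summable (\<lambda>n. of_nat (Suc n) * c (Suc n) * ?x ^ Suc n)"
      using summable_mult2 [OF \<open>summable (\<lambda>n. diffs c n * ?x ^ n)\<close>, of ?x]
      by (simp add: diffs_def algebra_simps)
    then have "summable (\<lambda>n. of_nat n * c n * ?x ^ n)"
      by (subst (asm) summable_Suc_iff)
    from suminf_split_head [OF this] show ?thesis by simp
  qed
  finally have eq: "(\<Sum>n. diffs c n * ?x ^ n) * (2 * of_real pi * \<i> * ?x) =
      2 * of_real pi * \<i> * (\<Sum>n. of_nat n * c n * ?x ^ n)"
    by (simp add: algebra_simps)
  show ?thesis
    using DERIV_chain2 [OF D nome_has_field_derivative] unfolding eq .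
qed

section \<open>Reflection formula for the polygamma functions\<close>

text \<open>The logarithmic derivative of the reflection formula of the Gamma function gives pi cot
  (pi z), which is a Moebius function of q and hence a geometric series.\<close>

lemma Digamma_reflection_nome:
  assumes "Im z > 0"
  shows "Digamma (1 - z) - Digamma z = of_real pi * \<i> - 2 * of_real pi * \<i> * (\<Sum>n. nome z ^ n)"
proof -
  have nonint: "z \<notin> \<int>" "1 - z \<notin> \<int>"
    using assms by (auto elim!: Ints_cases simp: complex_eq_iff)
  then have np: "z \<notin> \<int>\<^sub>\<le>\<^sub>0" "1 - z \<notin> \<int>\<^sub>\<le>\<^sub>0"
    using nonpos_Ints_Int by blast+
  let ?s = "sin (of_real pi * z)" and ?c = "cos (of_real pi * z)"
  have s0: "?s \<noteq> 0"
  proof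
    assume "?s = 0"
    then obtain n where n: "of_real pi * z = of_int n * of_real pi"
      by (auto simp: Complex_Transcendental.sin_eq_0)
    then have "z = of_int n" by simp
    then show False using nonint by simp
  qed
  have "((\<lambda>z. rGamma z * rGamma (1 - z)) has_field_derivative
          rGamma z * rGamma (1 - z) * (Digamma (1 - z) - Digamma z)) (at z)"
    using np by (auto intro!: derivative_eq_intros simp: algebra_simps)
  then have "((\<lambda>z. sin (of_real pi * z) / of_real pi) has_field_derivative
          ?s / of_real pi * (Digamma (1 - z) - Digamma z)) (at z)"
    by (simp add: rGamma_reflection_complex)
  moreover have "((\<lambda>z. sin (of_real pi * z) / of_real pi) has_field_derivative ?c) (at z)"
    by (auto intro!: derivative_eq_intros)
  ultimately have "?s / of_real pi * (Digamma (1 - z) - Digamma z) = ?c"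
    by (rule DERIV_unique)
  then have D: "Digamma (1 - z) - Digamma z = of_real pi * ?c / ?s"
    using s0 by (simp add: field_simps)
  \<comment> \<open>A square root of q, in which sine and cosine are rational.\<close>
  define e where "e = exp (\<i> * (of_real pi * z))"
  have e0: "e \<noteq> 0" by (simp add: e_def)
  have qe: "nome z = e ^ 2"
    by (simp add: nome_def e_def flip: exp_double) (simp add: algebra_simps)
  have em: "exp (- (\<i> * (of_real pi * z))) = inverse e"
    by (simp add: e_def exp_minus)
  have q1: "1 - e ^ 2 \<noteq> 0"
    using norm_nome_less_one [OF assms] qe by auto
  have "?s = \<i> * (1 - e ^ 2) / (2 * e)"
    unfolding sin_exp_eq em using e0 unfolding e_def [symmetric]
    by (simp add: field_simps power2_eq_square)
  moreover have "?c = (1 + e ^ 2) / (2 * e)"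
    unfolding cos_exp_eq em using e0 unfolding e_def [symmetric]
    by (simp add: field_simps power2_eq_square)
  ultimately have "of_real pi * ?c / ?s =
      of_real pi * ((1 + e ^ 2) / (2 * e)) / (\<i> * (1 - e ^ 2) / (2 * e))"
    by (simp only:)
  also have "\<dots> = of_real pi * \<i> - 2 * of_real pi * \<i> / (1 - e ^ 2)"
    using e0 q1 by (simp add: field_simps)
  finally have "of_real pi * ?c / ?s = of_real pi * \<i> - 2 * of_real pi * \<i> / (1 - e ^ 2)" .
  moreover have "(\<Sum>n. nome z ^ n) = 1 / (1 - e ^ 2)"
    using suminf_geometric [OF norm_nome_less_one [OF assms]] by (simp add: qe)
  ultimately show ?thesis
    using D by simp
qed

text \<open>Repeated differentiation of the case j = 0. Only there does the term n = 0 of the series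
  count, as \<open>0 ^ 0 = 1\<close>, and the constant pi i disappears with the first
  derivative.\<close>

lemma Polygamma_reflection_nome:
  assumes "Im z > 0"
  shows "(- 1) ^ j * Polygamma j (1 - z) - Polygamma j z =
      (if j = 0 then of_real pi * \<i> else 0)
        - (2 * of_real pi * \<i>) ^ Suc j * (\<Sum>n. of_nat n ^ j * nome z ^ n)"
  using assms
proof (induction j arbitrary: z)
  case 0
  then show ?case using Digamma_reflection_nome by simp
next
  case (Suc j)
  let ?f = "\<lambda>z. (- 1) ^ j * Polygamma j (1 - z) - Polygamma j z"
  let ?g = "\<lambda>z. (if j = 0 then of_real pi * \<i> else 0)
        - (2 * of_real pi * \<i>) ^ Suc j * (\<Sum>n. of_nat n ^ j * nome z ^ n)"
  have "z \<notin> \<int>" "1 - z \<notin> \<int>"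
    using Suc.prems by (auto elim!: Ints_cases simp: complex_eq_iff)
  then have np: "z \<notin> \<int>\<^sub>\<le>\<^sub>0" "1 - z \<notin> \<int>\<^sub>\<le>\<^sub>0"
    using nonpos_Ints_Int by blast+
  have 1: "(?f has_field_derivative ((- 1) ^ Suc j * Polygamma (Suc j) (1 - z) - Polygamma (Suc j) z)) (at z)"
    using np by (auto intro!: derivative_eq_intros)
  have "((\<lambda>z. \<Sum>n. of_nat n ^ j * nome z ^ n) has_field_derivative
          2 * of_real pi * \<i> * (\<Sum>n. of_nat n * of_nat n ^ j * nome z ^ n)) (at z)"
    by (rule powser_nome_has_field_derivative [where C = 1 and D = 0 and k = j])
       (use Suc.prems in \<open>auto simp: norm_power\<close>)
  then have "(?g has_field_derivative (0 - (2 * of_real pi * \<i>) ^ Suc j *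
      (2 * of_real pi * \<i> * (\<Sum>n. of_nat n * of_nat n ^ j * nome z ^ n)))) (at z)"
    by (intro DERIV_diff DERIV_const DERIV_cmult)
  then have "(?f has_field_derivative (0 - (2 * of_real pi * \<i>) ^ Suc j *
      (2 * of_real pi * \<i> * (\<Sum>n. of_nat n * of_nat n ^ j * nome z ^ n)))) (at z)"
  proof (rule has_field_derivative_transform_within_open)
    show "open {z. Im z > 0}" by (rule open_halfspace_Im_gt)
  qed (use Suc in auto)
  from DERIV_unique [OF 1 this] show ?case
    by (simp add: algebra_simps)
qed

section \<open>Sums over the integers and over the lattice\<close>

text \<open>The cut between n and -1 - n matches the polygamma series at z and 1 - z, because z +
  (-1 - n) = -(1 - z + n).\<close>

lemma has_sum_int_split:
  fixes f :: "int \<Rightarrow> 'a :: {topological_comm_monoid_add, t2_space}"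
  assumes "((\<lambda>n. f (int n)) has_sum a) UNIV" and "((\<lambda>n. f (- 1 - int n)) has_sum b) UNIV"
  shows "(f has_sum (a + b)) UNIV"
proof -
  have "(f has_sum a) (range int)"
    using assms(1) by (subst has_sum_reindex) (auto simp: o_def)
  moreover have "(f has_sum b) (range (\<lambda>n. - 1 - int n))"
    using assms(2) by (subst has_sum_reindex) (auto simp: o_def inj_on_def)
  moreover have "range int \<inter> range (\<lambda>n. - 1 - int n) = {}"
    by auto
  ultimately have "(f has_sum (a + b)) (range int \<union> range (\<lambda>n. - 1 - int n))"
    by (rule has_sum_Un_disjoint)
  moreover have "x \<in> range int \<union> range (\<lambda>n. - 1 - int n)" for x
  proof (cases "x \<ge> 0")
    case True
    then show ?thesis by (metis UnI1 rangeI zero_le_imp_eq_int)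
  next
    case False
    then have "x = - 1 - int (nat (- 1 - x))" by simp
    then show ?thesis by (metis UnI2 rangeI)
  qed
  then have "range int \<union> range (\<lambda>n. - 1 - int n) = UNIV" by auto
  ultimately show ?thesis by simp
qed

lemma summable_on_product_real:
  fixes f :: "'a \<Rightarrow> real" and g :: "'b \<Rightarrow> real"
  assumes "f summable_on A" and "g summable_on B"
    and "\<And>x. x \<in> A \<Longrightarrow> f x \<ge> 0" and "\<And>y. y \<in> B \<Longrightarrow> g y \<ge> 0"
  shows "(\<lambda>(x, y). f x * g y) summable_on A \<times> B"
proof (rule summable_on_SigmaI)
  show "((\<lambda>y. case (x, y) of (x, y) \<Rightarrow> f x * g y) has_sum f x * infsum g B) B" for x
    using has_sum_cmult_right [OF has_sum_infsum [OF assms(2)], of "f x"] by simp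
  show "(\<lambda>x. f x * infsum g B) summable_on A"
    using assms(1) by (rule summable_on_cmult_left)
qed (use assms in auto)

lemma summable_on_int_inverse_cube: "(\<lambda>n::int. 1 / (1 + real_of_int \<bar>n\<bar>) ^ 3) summable_on UNIV"
proof -
  have s: "summable (\<lambda>n. 1 / (1 + real n) ^ 3)"
    using inverse_power_summable [of 3, where ?'a = real] summable_Suc_iff [of "\<lambda>n. inverse (real n ^ 3)"]
    by (simp add: divide_inverse add_ac)
  then have s': "summable (\<lambda>n. 1 / (1 + real (Suc n)) ^ 3)"
    using summable_Suc_iff [of "\<lambda>n. 1 / (1 + real n) ^ 3"] by blast
  have 1: "(\<lambda>n. 1 / (1 + real_of_int \<bar>int n\<bar>) ^ 3) summable_on UNIV"
    using summable_nonneg_imp_summable_on [OF s] by simp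
  have "(\<lambda>n. 1 / (1 + real (Suc n)) ^ 3) summable_on UNIV"
    using s' by (rule summable_nonneg_imp_summable_on) simp
  also have "(\<lambda>n. 1 / (1 + real (Suc n)) ^ 3) = (\<lambda>n. 1 / (1 + real_of_int \<bar>- 1 - int n\<bar>) ^ 3)"
    by (simp add: fun_eq_iff)
  finally obtain b where "((\<lambda>n. 1 / (1 + real_of_int \<bar>- 1 - int n\<bar>) ^ 3) has_sum b) UNIV"
    by (auto simp: summable_on_def)
  from has_sum_int_split [OF has_sum_infsum [OF 1] this] show ?thesis
    by (rule has_sum_imp_summable)
qed

text \<open>If |m| |\<tau>| is at most |n|/2, the summand n dominates; otherwise |n| is bounded by a
  multiple of |m|, and the imaginary part m Im \<tau> controls both.\<close>

lemma norm_lattice_ge: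
  assumes "Im \<tau> > 0"
  obtains c :: real where "c > 0"
    "\<And>m n :: int. c * real_of_int (max \<bar>m\<bar> \<bar>n\<bar>) \<le> norm (of_int m * \<tau> + of_int n)"
proof
  define y where "y = Im \<tau>"
  define t where "t = norm \<tau>"
  have t: "t > 0" "y \<le> t" "y > 0"
    using assms abs_Im_le_cmod [of \<tau>] by (auto simp: y_def t_def)
  \<comment> \<open>The three entries serve |m|, then |n| where n dominates, then |n| in the
    remaining case.\<close>
  define c where "c = min y (min (1 / 2) (y / (2 * t)))"
  show "c > 0" using t by (simp add: c_def)
  fix m n :: int
  let ?w = "of_int m * \<tau> + of_int n"
  have im: "\<bar>m\<bar> * y \<le> norm ?w"
    using abs_Im_le_cmod [of ?w] t by (simp add: abs_mult y_def)
  have "c * \<bar>m\<bar> \<le> y * \<bar>m\<bar>"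
    by (intro mult_right_mono) (auto simp: c_def)
  then have m: "c * \<bar>m\<bar> \<le> norm ?w" using im by (simp add: mult.commute)
  have n: "c * \<bar>n\<bar> \<le> norm ?w"
  proof (cases "\<bar>m\<bar> * t \<le> \<bar>n\<bar> / 2")
    case True
    have "norm (of_int n :: complex) \<le> norm ?w + norm (of_int m * \<tau>)"
      using norm_triangle_ineq4 [of ?w "of_int m * \<tau>"] by simp
    then have "\<bar>n\<bar> / 2 \<le> norm ?w"
      using True by (simp add: norm_mult t_def)
    moreover have "c * \<bar>n\<bar> \<le> 1 / 2 * \<bar>n\<bar>"
      by (intro mult_right_mono) (auto simp: c_def)
    ultimately show ?thesis by simp
  next
    case False
    have "c * \<bar>n\<bar> \<le> y / (2 * t) * \<bar>n\<bar>"
      by (intro mult_right_mono) (auto simp: c_def)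
    also have "\<dots> = y / t * (\<bar>n\<bar> / 2)" by simp
    also have "\<dots> \<le> y / t * (\<bar>m\<bar> * t)"
      using False t by (intro mult_left_mono) auto
    also have "\<dots> = \<bar>m\<bar> * y" using t by simp
    finally show ?thesis using im by simp
  qed
  show "c * real_of_int (max \<bar>m\<bar> \<bar>n\<bar>) \<le> norm ?w"
    using m n by (simp add: max_def)
qed

text \<open>By \<open>norm_lattice_ge\<close> the sixth power of the norm is at least a multiple of
  max(|m|, |n|)^6, hence of (1 + |m|)^3 (1 + |n|)^3, so a product of two one-dimensional series is a
  majorant. The 64 is 4^3: away from the origin each of 1 + |m| and 1 + |n| is at most twice the
  maximum.\<close>

lemma abs_summable_lattice:
  assumes "Im \<tau> > 0"
  shows "(\<lambda>x. norm (case x of (m, n) \<Rightarrow> 1 / (of_int m * \<tau> + of_int n) ^ 6)) summable_on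
    (UNIV :: (int \<times> int) set) - {(0, 0)}"
proof -
  obtain c :: real where c: "c > 0" "\<And>m n :: int. c * real_of_int (max \<bar>m\<bar> \<bar>n\<bar>) \<le> norm (of_int m * \<tau> + of_int n)"
    using norm_lattice_ge [OF assms] by blast
  let ?g = "\<lambda>n::int. 1 / (1 + real_of_int \<bar>n\<bar>) ^ 3"
  have "(\<lambda>(m, n). ?g m * ?g n) summable_on UNIV \<times> UNIV"
    by (intro summable_on_product_real summable_on_int_inverse_cube) auto
  then have "(\<lambda>x. 64 / c ^ 6 * (case x of (m, n) \<Rightarrow> ?g m * ?g n)) summable_on (UNIV :: (int \<times> int) set)"
    by (intro summable_on_cmult_right) simp
  then have "(\<lambda>x. 64 / c ^ 6 * (case x of (m, n) \<Rightarrow> ?g m * ?g n)) summable_on (UNIV :: (int \<times> int) set) - {(0, 0)}"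
    by (rule summable_on_subset) auto
  then show ?thesis
  proof (rule Infinite_Sum.abs_summable_on_comparison_test')
    fix x :: "int \<times> int"
    assume x: "x \<in> UNIV - {(0, 0)}"
    obtain m n where mn: "x = (m, n)" by fastforce
    define M where "M = max (real_of_int \<bar>m\<bar>) (real_of_int \<bar>n\<bar>)"
    have M: "M \<ge> 1" "real_of_int \<bar>m\<bar> \<le> M" "real_of_int \<bar>n\<bar> \<le> M"
      using x mn by (auto simp: M_def max_def)
    have "c * M \<le> norm (of_int m * \<tau> + of_int n)"
      using c(2) [of m n] by (simp add: M_def of_int_max)
    then have 1: "(c * M) ^ 6 \<le> norm (of_int m * \<tau> + of_int n) ^ 6"
      using c M by (intro power_mono) auto
    have "(1 + real_of_int \<bar>m\<bar>) * (1 + real_of_int \<bar>n\<bar>) \<le> (2 * M) * (2 * M)"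
      using M by (intro mult_mono) auto
    then have "((1 + real_of_int \<bar>m\<bar>) * (1 + real_of_int \<bar>n\<bar>)) ^ 3 \<le> ((2 * M) * (2 * M)) ^ 3"
      by (intro power_mono) auto
    also have "\<dots> = 64 * M ^ 6" by (simp add: power_mult_distrib flip: power_add)
    finally have 2: "(1 + real_of_int \<bar>m\<bar>) ^ 3 * (1 + real_of_int \<bar>n\<bar>) ^ 3 \<le> 64 * M ^ 6"
      by (simp add: power_mult_distrib)
    have pos: "c * M > 0" using c M by simp
    have "1 / norm (of_int m * \<tau> + of_int n) ^ 6 \<le> 1 / (c * M) ^ 6"
      using 1 pos by (intro frac_le) auto
    also have "\<dots> = 64 / c ^ 6 * (1 / (64 * M ^ 6))"
      by (simp add: power_mult_distrib)
    also have "\<dots> \<le> 64 / c ^ 6 * (1 / ((1 + real_of_int \<bar>m\<bar>) ^ 3 * (1 + real_of_int \<bar>n\<bar>) ^ 3))"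
      using 2 c M by (intro mult_left_mono divide_left_mono mult_pos_pos zero_less_power) auto
    finally show "norm (case x of (m, n) \<Rightarrow> 1 / (of_int m * \<tau> + of_int n) ^ 6) \<le>
        64 / c ^ 6 * (case x of (m, n) \<Rightarrow> ?g m * ?g n)"
      by (simp add: mn norm_divide norm_power)
  qed
qed

section \<open>Translation and inversion of the lattice sum\<close>

lemma g3_plus_int: "g3 (\<tau> + of_int k) = g3 \<tau>"
proof -
  have "(\<Sum>\<^sub>\<infinity>(m, n) \<in> (UNIV :: (int \<times> int) set) - {(0, 0)}. 1 / (of_int m * (\<tau> + of_int k) + of_int n) ^ 6)
      = (\<Sum>\<^sub>\<infinity>(m, n) \<in> (UNIV :: (int \<times> int) set) - {(0, 0)}. 1 / (of_int m * \<tau> + of_int n) ^ 6)"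
    by (rule infsum_reindex_bij_witness [where j = "\<lambda>(m, n). (m, n + m * k)" and i = "\<lambda>(m, n). (m, n - m * k)"])
       (auto simp: algebra_simps)
  then show ?thesis by (simp add: g3_def)
qed

text \<open>Factoring 1/\<tau> out of the lattice spanned by 1 and -1/\<tau> leaves the lattice
  spanned by 1 and \<tau>.\<close>

lemma g3_inversion:
  assumes "\<tau> \<noteq> 0"
  shows "g3 (- 1 / \<tau>) = \<tau> ^ 6 * g3 \<tau>"
proof -
  have "(\<Sum>\<^sub>\<infinity>(m, n) \<in> (UNIV :: (int \<times> int) set) - {(0, 0)}. 1 / (of_int m * (- 1 / \<tau>) + of_int n) ^ 6)
      = (\<Sum>\<^sub>\<infinity>(m, n) \<in> (UNIV :: (int \<times> int) set) - {(0, 0)}. \<tau> ^ 6 * (1 / (of_int m * \<tau> + of_int n) ^ 6))"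
  proof (rule infsum_reindex_bij_witness [where j = "\<lambda>(m, n). (n, - m)" and i = "\<lambda>(m, n). (- n, m)"], goal_cases)
    case (5 a)
    obtain m n where "a = (m, n)" by fastforce
    moreover have "of_int m * (- 1 / \<tau>) + of_int n = (of_int n * \<tau> + of_int (- m)) / \<tau>"
      using assms by (simp add: field_simps)
    ultimately show ?case
      by (simp only: case_prod_conv power_divide) simp
  qed auto
  also have "\<dots> = \<tau> ^ 6 * (\<Sum>\<^sub>\<infinity>(m, n) \<in> (UNIV :: (int \<times> int) set) - {(0, 0)}. 1 / (of_int m * \<tau> + of_int n) ^ 6)"
    by (simp only: case_prod_unfold infsum_cmult_right')
  finally show ?thesis by (simp add: g3_def)
qed

text \<open>The terms with n \<ge> 0 sum to the polygamma value of order 5 at z over 5!, those with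
  n < 0 to the value at 1 - z over 5!, the exponent 6 being even. The factor is (2 pi i)^6 / 5! = -
  8 pi^6 / 15.\<close>

lemma has_sum_inverse_sixth_powers:
  assumes "Im z > 0"
  shows "((\<lambda>n::int. 1 / (z + of_int n) ^ 6) has_sum
           - (8 * of_real pi ^ 6 / 15) * (\<Sum>n. of_nat n ^ 5 * nome z ^ n)) UNIV"
proof -
  let ?f = "\<lambda>n::int. 1 / (z + of_int n) ^ 6"
  \<comment> \<open>Convergence is read off the row m = 1 of the lattice sum.\<close>
  have "(\<lambda>(m, n). 1 / (of_int m * z + of_int n) ^ 6) summable_on (UNIV :: (int \<times> int) set) - {(0, 0)}"
    using abs_summable_summable [OF abs_summable_lattice [OF assms]] .
  then have "(\<lambda>(m, n). 1 / (of_int m * z + of_int n) ^ 6) summable_on (Pair (1::int)) ` (UNIV :: int set)"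
    by (rule summable_on_subset) auto
  then have sf: "?f summable_on UNIV"
    by (subst (asm) summable_on_reindex) (auto simp: o_def inj_on_def)
  have "?f summable_on range int"
    using sf by (rule summable_on_subset) auto
  then have "(\<lambda>n. ?f (int n)) summable_on UNIV"
    by (subst (asm) summable_on_reindex) (auto simp: o_def)
  then have 1: "((\<lambda>n. ?f (int n)) has_sum (\<Sum>\<^sub>\<infinity>n. ?f (int n))) UNIV" by (rule has_sum_infsum)
  have "?f summable_on range (\<lambda>n. - 1 - int n)"
    using sf by (rule summable_on_subset) auto
  then have "(\<lambda>n. ?f (- 1 - int n)) summable_on UNIV"
    by (subst (asm) summable_on_reindex) (auto simp: o_def inj_on_def)
  then have 2: "((\<lambda>n. ?f (- 1 - int n)) has_sum (\<Sum>\<^sub>\<infinity>n. ?f (- 1 - int n))) UNIV" by (rule has_sum_infsum)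
  have z: "z \<noteq> 0" "1 - z \<noteq> 0" using assms by auto
  have fact5: "fact 5 = (120 :: complex)"
    by (simp add: fact_numeral)
  have six: "inverse (w ^ Suc 5) = 1 / w ^ 6" for w :: complex
    by (simp only: inverse_eq_divide) simp
  have PG: "(\<lambda>k. 1 / (w + of_nat k) ^ 6) sums (Polygamma 5 w / 120)" if "w \<noteq> 0" for w :: complex
    using Polygamma_LIMSEQ [of w 5] that unfolding six fact5 by simp
  have "(\<lambda>n. ?f (int n)) sums (Polygamma 5 z / 120)"
    using PG [OF z(1)] by simp
  with has_sum_imp_sums [OF 1] have e1: "(\<Sum>\<^sub>\<infinity>n. ?f (int n)) = Polygamma 5 z / 120"
    by (rule sums_unique2)
  have neg: "z + of_int (- 1 - int n) = - (1 - z + of_nat n)" for n by simp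
  have even: "1 / (- w) ^ 6 = 1 / w ^ 6" for w :: complex
    by simp
  have "(\<lambda>n. ?f (- 1 - int n)) sums (Polygamma 5 (1 - z) / 120)"
    unfolding neg even by (rule PG [OF z(2)])
  with has_sum_imp_sums [OF 2] have e2: "(\<Sum>\<^sub>\<infinity>n. ?f (- 1 - int n)) = Polygamma 5 (1 - z) / 120"
    by (rule sums_unique2)
  have "- Polygamma 5 (1 - z) - Polygamma 5 z = 64 * of_real pi ^ 6 * (\<Sum>n. of_nat n ^ 5 * nome z ^ n)"
    using Polygamma_reflection_nome [OF assms, of 5] by (simp add: power_mult_distrib)
  moreover have "Polygamma 5 z / 120 + Polygamma 5 (1 - z) / 120 =
      - (- Polygamma 5 (1 - z) - Polygamma 5 z) / 120"
    by (simp add: field_simps)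
  ultimately have eq: "Polygamma 5 z / 120 + Polygamma 5 (1 - z) / 120 =
      - (8 * of_real pi ^ 6 / 15) * (\<Sum>n. of_nat n ^ 5 * nome z ^ n)"
    by simp
  show ?thesis
    using has_sum_int_split [OF 1 2] unfolding e1 e2 eq .
qed

subsection \<open>Fourier expansion\<close>

text \<open>Note \<open>sigma5 0 = 0\<close>: the set of divisors of \<open>0\<close> is infinite.\<close>

definition sigma5 :: "nat \<Rightarrow> nat" where
  "sigma5 n = (\<Sum>d | d dvd n. d ^ 5)"

lemma sigma5_0 [simp]: "sigma5 0 = 0"
  by (simp add: sigma5_def)

lemma sigma5_1 [simp]: "sigma5 (Suc 0) = 1"
  by (simp add: sigma5_def)

lemma sigma5_2 [simp]: "sigma5 2 = 33"
proof -
  have "d = 1 \<or> d = 2" if "d dvd 2" for d :: nat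
  proof -
    have "d \<le> 2" using that by (rule dvd_imp_le) simp
    then have "d = 0 \<or> d = 1 \<or> d = 2" by arith
    with that show ?thesis by auto
  qed
  then have "{d :: nat. d dvd 2} = {1, 2}" by auto
  then show ?thesis by (simp add: sigma5_def)
qed

lemma sigma5_le: "sigma5 n \<le> n ^ 6"
proof (cases "n = 0")
  case False
  have "sigma5 n \<le> (\<Sum>d | d dvd n. n ^ 5)"
    unfolding sigma5_def using False by (intro sum_mono power_mono) (auto dest: dvd_imp_le)
  also have "\<dots> = card {d. d dvd n} * n ^ 5" by simp
  also have "card {d. d dvd n} \<le> card {1..n}"
    using False by (intro card_mono) (auto dest: dvd_imp_le simp: Suc_le_eq intro: Nat.gr0I)
  finally show ?thesis by (simp add: eval_nat_numeral)
qed simp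

lemma norm_sigma5_le: "norm (of_nat n ^ j * of_nat (sigma5 n) :: complex) \<le> 1 * real n ^ (j + 6) + 0"
proof -
  have "real (sigma5 n) \<le> real n ^ 6"
    using sigma5_le [of n] by (simp flip: of_nat_power)
  then show ?thesis
    by (simp add: norm_mult norm_power power_add mult_left_mono)
qed

text \<open>Absolute convergence allows grouping the terms n^5 q^((k + 1) n) by the exponent N = (k
  + 1) n, in which n runs through the divisors of N.\<close>

lemma has_sum_Lambert_sigma5:
  fixes q :: complex
  assumes "norm q < 1"
  shows "((\<lambda>k. \<Sum>n. of_nat n ^ 5 * (q ^ Suc k) ^ n) has_sum (\<Sum>N. of_nat (sigma5 N) * q ^ N)) UNIV"
proof -
  let ?f = "\<lambda>(k, n). of_nat n ^ 5 * (q ^ Suc k) ^ n :: complex"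
  \<comment> \<open>The terms with n = 0 vanish; leaving them out makes (k, n) -> ((k + 1) n, n) a
    bijection onto the pairs of some N \<ge> 1 and a divisor of N.\<close>
  let ?P = "UNIV \<times> {1..} :: (nat \<times> nat) set"
  have "(\<lambda>(k, n). norm q ^ k * (real n ^ 5 * norm q ^ n)) summable_on ?P"
  proof (rule summable_on_product_real)
    show "(\<lambda>k. norm q ^ k) summable_on UNIV"
      using assms by (intro summable_nonneg_imp_summable_on summable_geometric) auto
    have "(\<lambda>n. real n ^ 5 * norm q ^ n) summable_on UNIV"
      using assms by (intro summable_nonneg_imp_summable_on summable_power_mult_geometric) auto
    then show "(\<lambda>n. real n ^ 5 * norm q ^ n) summable_on {1..}"
      by (rule summable_on_subset) auto
  qed auto
  then have "(\<lambda>x. norm (?f x)) summable_on ?P"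
  proof (rule Infinite_Sum.abs_summable_on_comparison_test')
    fix x :: "nat \<times> nat" assume "x \<in> ?P"
    then obtain k m where x: "x = (k, Suc m)"
      by (metis SigmaE atLeast_iff One_nat_def Suc_le_D)
    \<comment> \<open>Since (k + 1)(m + 1) \<ge> k + (m + 1), a product of two single series is a
      majorant.\<close>
    have "norm q ^ (Suc k * Suc m) \<le> norm q ^ (k + Suc m)"
      using assms by (intro power_decreasing) auto
    then have "real (Suc m) ^ 5 * norm q ^ (Suc k * Suc m) \<le> real (Suc m) ^ 5 * norm q ^ (k + Suc m)"
      by (intro mult_left_mono) auto
    moreover have "norm (of_nat (Suc m) :: complex) = real (Suc m)"
      by (rule norm_of_nat)
    ultimately show "norm (?f x) \<le> (case x of (k, n) \<Rightarrow> norm q ^ k * (real n ^ 5 * norm q ^ n))"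
      unfolding x case_prod_conv norm_mult norm_power power_mult [symmetric] power_add
      by (simp only: mult_ac)
  qed
  then have "?f summable_on ?P" by (rule abs_summable_summable)
  then obtain S where S: "(?f has_sum S) ?P" by (auto simp: summable_on_def)
  have "((\<lambda>k. \<Sum>n. of_nat n ^ 5 * (q ^ Suc k) ^ n) has_sum S) UNIV"
  proof (rule has_sum_SigmaD [OF S])
    fix k :: nat
    have "norm q ^ Suc k \<le> norm q ^ 1"
      using assms by (intro power_decreasing) auto
    then have "norm (q ^ Suc k) < 1"
      using assms by (simp add: norm_power norm_mult)
    then have sn: "summable (\<lambda>n. norm (of_nat n ^ 5 * (q ^ Suc k) ^ n))"
      by (intro summable_norm_powser_poly_growth [where C = 1 and k = 5 and D = 0])
         (auto simp: norm_power)
    have "((\<lambda>n. of_nat n ^ 5 * (q ^ Suc k) ^ n) has_sum (\<Sum>n. of_nat n ^ 5 * (q ^ Suc k) ^ n)) UNIV"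
      by (rule norm_summable_imp_has_sum [OF sn summable_sums [OF summable_norm_cancel [OF sn]]])
    then have "((\<lambda>n. of_nat n ^ 5 * (q ^ Suc k) ^ n) has_sum (\<Sum>n. of_nat n ^ 5 * (q ^ Suc k) ^ n)) {1..}"
      by (rule has_sum_cong_neutral [THEN iffD1, rotated -1]) (auto simp: not_le)
    then show "((\<lambda>n. ?f (k, n)) has_sum (\<Sum>n. of_nat n ^ 5 * (q ^ Suc k) ^ n)) {1..}"
      by simp
  qed
  moreover
  let ?g = "\<lambda>(N, d). of_nat d ^ 5 * q ^ N :: complex"
  let ?D = "SIGMA N : {1..}. {d :: nat. d dvd N}"
  have "(?g has_sum S) ?D"
  proof -
    have "(?f has_sum S) ?P = (?g has_sum S) ?D"
    proof (rule has_sum_reindex_bij_witness [where j = "\<lambda>(k, n). (Suc k * n, n)"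
            and i = "\<lambda>(N, d). (N div d - 1, d)"], goal_cases)
      case (3 b)
      then obtain N d where b: "b = (N, d)" "N \<ge> 1" "d dvd N" by auto
      then obtain e where e: "N = d * e" by blast
      with b have "d > 0" "e \<noteq> 0" by (auto intro!: Nat.gr0I)
      moreover from \<open>e \<noteq> 0\<close> obtain e' where "e = Suc e'"
        using not0_implies_Suc by blast
      ultimately show ?case using b e by (simp add: mult.commute)
    next
      case (4 b)
      then show ?case by (auto simp: Suc_le_eq intro!: Nat.gr0I)
    next
      case (5 a)
      then show ?case by (auto simp del: power_Suc simp flip: power_mult)
    qed (auto simp: dvd_triv_right)
    with S show ?thesis by simp
  qed
  then have "((\<lambda>N. of_nat (sigma5 N) * q ^ N) has_sum S) {1..}"
  proof (rule has_sum_SigmaD)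
    fix N :: nat assume "N \<in> {1..}"
    then have "finite {d. d dvd N}" by simp
    then have "((\<lambda>d. ?g (N, d)) has_sum (\<Sum>d | d dvd N. of_nat d ^ 5 * q ^ N)) {d. d dvd N}"
      by (subst case_prod_conv) (rule has_sum_finite)
    then show "((\<lambda>d. ?g (N, d)) has_sum of_nat (sigma5 N) * q ^ N) {d. d dvd N}"
      by (simp add: sigma5_def sum_distrib_right)
  qed
  then have "((\<lambda>N. of_nat (sigma5 N) * q ^ N) has_sum S) UNIV"
    by (rule has_sum_cong_neutral [THEN iffD1, rotated -1]) (auto simp: not_le)
  then have "(\<lambda>N. of_nat (sigma5 N) * q ^ N) sums S"
    by (rule has_sum_imp_sums)
  then have "S = (\<Sum>N. of_nat (sigma5 N) * q ^ N)" by (rule sums_unique)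
  ultimately show ?thesis by simp
qed

definition zeta6 :: real where
  "zeta6 = (\<Sum>n. 1 / (real n + 1) ^ 6)"

lemma summable_zeta6: "summable (\<lambda>n. 1 / (real n + 1) ^ 6)"
  using inverse_power_summable [of 6, where ?'a = real] summable_Suc_iff [of "\<lambda>n. inverse (real n ^ 6)"]
  by (simp add: divide_inverse add_ac)

lemma has_sum_zeta6:
  "((\<lambda>n::int. 1 / (of_int n :: complex) ^ 6) has_sum of_real (2 * zeta6)) (UNIV - {0})"
proof -
  have "((\<lambda>n. 1 / (real n + 1) ^ 6) has_sum zeta6) UNIV"
    unfolding zeta6_def by (rule sums_nonneg_imp_has_sum [OF summable_sums [OF summable_zeta6]]) simp
  then have 1: "((\<lambda>n. of_real (1 / (real n + 1) ^ 6)) has_sum (of_real zeta6 :: complex)) UNIV"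
    by (rule has_sum_of_real)
  let ?h = "\<lambda>n::int. if n = 0 then 0 else 1 / (of_int n :: complex) ^ 6"
  have neg: "(of_int (- 1 - int n) :: complex) = - (of_nat n + 1)" for n by simp
  have b: "((\<lambda>n. ?h (- 1 - int n)) has_sum (of_real zeta6 :: complex)) UNIV"
  proof -
    have "?h (- 1 - int n) = of_real (1 / (real n + 1) ^ 6)" for n
    proof -
      have "- 1 - int n \<noteq> 0" by simp
      moreover have even: "1 / (- w) ^ 6 = 1 / w ^ 6" for w :: complex by simp
      ultimately show ?thesis unfolding neg even by simp
    qed
    with 1 show ?thesis by simp
  qed
  have a: "((\<lambda>n. ?h (int n)) has_sum (of_real zeta6 :: complex)) UNIV"
  proof -
    have "((\<lambda>n. ?h (int n)) has_sum (of_real zeta6 :: complex)) (range Suc)"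
      using 1 by (subst has_sum_reindex) (auto simp: o_def add_ac)
    then show ?thesis
      by (rule has_sum_cong_neutral [THEN iffD1, rotated -1]) (auto simp: image_iff gr0_conv_Suc dest!: not0_implies_Suc)
  qed
  from has_sum_int_split [OF a b]
  have "(?h has_sum of_real (2 * zeta6)) UNIV" by simp
  then show ?thesis
    by (rule has_sum_cong_neutral [THEN iffD1, rotated -1]) auto
qed

text \<open>Summation by rows: m = 0 gives 2 zeta(6), and for m > 0 each of the rows m and -m gives
  the Lipschitz series at m \<tau>, whose nome is q^m. Over all m > 0 these form the Lambert series
  of sigma_5.\<close>

lemma g3_q_expansion:
  assumes "Im \<tau> > 0"
  shows "g3 \<tau> = 280 * (of_real zeta6 - 8 * of_real pi ^ 6 / 15 * (\<Sum>N. of_nat (sigma5 N) * nome \<tau> ^ N))"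
proof -
  define f where "f = (\<lambda>(m :: int, n :: int). 1 / (of_int m * \<tau> + of_int n) ^ 6)"
  define B where "B = (\<lambda>m :: int. if m = 0 then UNIV - {0} else UNIV :: int set)"
  define C :: complex where "C = - (8 * of_real pi ^ 6 / 15)"
  define L where "L = (\<lambda>k. \<Sum>n. of_nat n ^ 5 * (nome \<tau> ^ Suc k) ^ n)"
  define S where "S = (\<Sum>N. of_nat (sigma5 N) * nome \<tau> ^ N)"
  \<comment> \<open>\<open>L k\<close> belongs to the rows k + 1 and -(k + 1), whence the shift by
    1.\<close>
  define g where "g = (\<lambda>m :: int. if m = 0 then of_real (2 * zeta6) else C * L (nat (\<bar>m\<bar> - 1)))"
  have set: "(UNIV :: (int \<times> int) set) - {(0, 0)} = Sigma UNIV B"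
    by (auto simp: B_def split: if_splits)
  have "f summable_on Sigma UNIV B"
    using abs_summable_summable [OF abs_summable_lattice [OF assms]] unfolding set f_def .
  then have "(f has_sum infsum f (Sigma UNIV B)) (Sigma UNIV B)"
    by (rule has_sum_infsum)
  then have g: "(g has_sum infsum f (Sigma UNIV B)) UNIV"
  proof (rule has_sum_SigmaD)
    fix m :: int
    have pos: "((\<lambda>n. f (int (Suc k), n)) has_sum C * L k) UNIV" for k
    proof -
      have "Im (of_nat (Suc k) * \<tau>) > 0" using assms by (simp del: of_nat_Suc)
      from has_sum_inverse_sixth_powers [OF this]
      have "((\<lambda>n. 1 / (of_nat (Suc k) * \<tau> + of_int n) ^ 6) has_sum
          C * (\<Sum>n. of_nat n ^ 5 * nome (of_nat (Suc k) * \<tau>) ^ n)) UNIV"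
        by (simp only: C_def)
      moreover have "nome (of_nat (Suc k) * \<tau>) = nome \<tau> ^ Suc k"
        unfolding nome_def exp_of_nat_mult [symmetric] by (simp only: mult_ac)
      ultimately show ?thesis by (simp add: f_def L_def)
    qed
    consider "m = 0" | k where "m = int (Suc k)" | k where "m = - int (Suc k)"
      by (metis int_cases4 not0_implies_Suc of_nat_0_eq_iff less_irrefl)
    then show "((\<lambda>n. f (m, n)) has_sum g m) (B m)"
    proof cases
      case 1
      then show ?thesis using has_sum_zeta6 by (simp add: f_def g_def B_def)
    next
      case (2 k)
      then show ?thesis using pos [of k] by (simp add: g_def B_def)
    next
      case (3 k)
      \<comment> \<open>A row with negative index is the row of opposite index read with n replaced
        by -n, as the exponent 6 is even.\<close>
      have "((\<lambda>n. f (int (Suc k), - n)) has_sum C * L k) UNIV"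
        using pos [of k] by (subst (asm) has_sum_reindex_bij_betw [of uminus UNIV UNIV, symmetric])
          (auto intro!: bij_betwI [where g = uminus])
      moreover have "f (int (Suc k), - n) = f (m, n)" for n
      proof -
        have e: "of_int m * \<tau> + of_int n = - (of_int (int (Suc k)) * \<tau> + of_int (- n))"
          by (simp add: 3 algebra_simps)
        have ev: "1 / (- w) ^ 6 = 1 / w ^ 6" for w :: complex by simp
        show ?thesis unfolding f_def case_prod_conv e ev ..
      qed
      ultimately show ?thesis using 3 by (simp add: g_def B_def)
    qed
  qed
  have L: "((\<lambda>k. C * L k) has_sum C * S) UNIV"
    unfolding L_def S_def using norm_nome_less_one [OF assms]
    by (intro has_sum_cmult_right has_sum_Lambert_sigma5)
  have b: "((\<lambda>n. g (- 1 - int n)) has_sum C * S) UNIV"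
  proof -
    have "g (- 1 - int n) = C * L n" for n
    proof -
      have "- 1 - int n \<noteq> 0" "nat (\<bar>- 1 - int n\<bar> - 1) = n" by auto
      then show ?thesis by (simp only: g_def if_False)
    qed
    with L show ?thesis by simp
  qed
  have "((\<lambda>n. g (int n)) has_sum of_real (2 * zeta6) + C * S) UNIV"
  proof -
    have "((\<lambda>n. g (int n)) has_sum C * S) (range Suc)"
      using L by (subst has_sum_reindex) (auto simp: o_def g_def)
    moreover have "((\<lambda>n. g (int n)) has_sum g 0) {0}"
      using has_sum_finite [of "{0}" "\<lambda>n. g (int n)"] by simp
    ultimately have "((\<lambda>n. g (int n)) has_sum g 0 + C * S) ({0} \<union> range Suc)"
      by (intro has_sum_Un_disjoint) auto
    moreover have "{0} \<union> range Suc = UNIV"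
      by (auto simp: image_iff) (metis not0_implies_Suc)
    ultimately show ?thesis by (simp add: g_def)
  qed
  from has_sum_unique [OF has_sum_int_split [OF this b] g]
  have "infsum f (Sigma UNIV B) = of_real (2 * zeta6) + C * S + C * S" ..
  then have "g3 \<tau> = 140 * (of_real (2 * zeta6) + C * S + C * S)"
    by (simp add: g3_def set f_def)
  then show ?thesis by (simp add: C_def S_def algebra_simps)
qed

lemma g3_has_field_derivative:
  assumes "Im \<tau> > 0"
  shows "(g3 has_field_derivative
      - (896 * of_real pi ^ 7 / 3 * \<i> * (\<Sum>N. of_nat N * of_nat (sigma5 N) * nome \<tau> ^ N))) (at \<tau>)"
proof -
  have "((\<lambda>\<tau>. \<Sum>N. of_nat (sigma5 N) * nome \<tau> ^ N) has_field_derivative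
      2 * of_real pi * \<i> * (\<Sum>N. of_nat N * of_nat (sigma5 N) * nome \<tau> ^ N)) (at \<tau>)"
    using norm_sigma5_le [of _ 0] assms
    by (intro powser_nome_has_field_derivative [where C = 1 and k = 6 and D = 0]) simp_all
  then have "((\<lambda>\<tau>. 280 * (of_real zeta6 - 8 * of_real pi ^ 6 / 15 * (\<Sum>N. of_nat (sigma5 N) * nome \<tau> ^ N)))
      has_field_derivative 280 * (0 - 8 * of_real pi ^ 6 / 15 *
      (2 * of_real pi * \<i> * (\<Sum>N. of_nat N * of_nat (sigma5 N) * nome \<tau> ^ N)))) (at \<tau>)"
    by (intro DERIV_cmult DERIV_diff DERIV_const)
  then have "(g3 has_field_derivative 280 * (0 - 8 * of_real pi ^ 6 / 15 *
      (2 * of_real pi * \<i> * (\<Sum>N. of_nat N * of_nat (sigma5 N) * nome \<tau> ^ N)))) (at \<tau>)"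
  proof (rule has_field_derivative_transform_within_open)
    show "open {z. Im z > 0}" by (rule open_halfspace_Im_gt)
  qed (use assms g3_q_expansion in auto)
  then show ?thesis by (simp add: eval_nat_numeral mult_ac)
qed

lemma deriv_g3:
  assumes "Im \<tau> > 0"
  shows "deriv g3 \<tau> = - (896 * of_real pi ^ 7 / 3 * \<i> * (\<Sum>N. of_nat N * of_nat (sigma5 N) * nome \<tau> ^ N))"
  using g3_has_field_derivative [OF assms] by (rule DERIV_imp_deriv)

section \<open>Truncation of the q-series\<close>

text \<open>The ratio (n + 4)/(n + 3) is at most 4/3, and (4/3)^8 is just below 10. Exponents up to
  8 occur: \<open>sigma5_le\<close> contributes 6, and \<open>sigma5_gf1_D\<close> has two further
  factors of size n.\<close>

lemma plus3_power_le:
  assumes "k \<le> 8"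
  shows "(real n + 3) ^ k \<le> 3 ^ k * 10 ^ n"
proof -
  have "((real n + 3) / 3) ^ 8 \<le> 10 ^ n"
  proof (induction n)
    case (Suc n)
    have "(real (Suc n) + 3) / 3 \<le> 4 / 3 * ((real n + 3) / 3)" by simp
    then have "((real (Suc n) + 3) / 3) ^ 8 \<le> (4 / 3 * ((real n + 3) / 3)) ^ 8"
      by (intro power_mono) auto
    also have "\<dots> = (4 / 3) ^ 8 * ((real n + 3) / 3) ^ 8" by (rule power_mult_distrib)
    also have "\<dots> \<le> 10 * 10 ^ n"
      using Suc by (intro mult_mono) (auto simp: power_divide)
    finally show ?case by simp
  qed simp
  moreover have "((real n + 3) / 3) ^ k \<le> ((real n + 3) / 3) ^ 8"
    using assms by (intro power_increasing) auto
  ultimately have "((real n + 3) / 3) ^ k \<le> 10 ^ n" by linarith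
  then show ?thesis by (simp add: power_divide field_simps)
qed

text \<open>From index 2 on the series is majorised by a geometric one of ratio 10 |q| \<le> 1/23,
  which accounts for the factor 1/(1 - 1/23) = 23/22.\<close>

lemma powser_second_order_bound:
  fixes c :: "nat \<Rightarrow> complex"
  assumes c: "\<And>n. norm (c (n + 2)) \<le> 3 ^ k * 10 ^ n" and q: "norm q \<le> 1 / 230"
  shows "norm ((\<Sum>n. c n * q ^ n) - (c 0 + c 1 * q)) \<le> 3 ^ k * 23 / 22 * norm q ^ 2"
proof -
  let ?r = "norm q"
  have r10: "10 * ?r \<le> 1 / 23" using q by simp
  have b: "norm (c (n + 2) * q ^ (n + 2)) \<le> 3 ^ k * ?r ^ 2 * (10 * ?r) ^ n" for n
  proof -
    have "norm (c (n + 2)) * ?r ^ (n + 2) \<le> 3 ^ k * 10 ^ n * ?r ^ (n + 2)"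
      using c by (intro mult_right_mono) auto
    then show ?thesis by (simp add: norm_mult norm_power power_mult_distrib power_add power2_eq_square mult_ac)
  qed
  have g: "summable (\<lambda>n. 3 ^ k * ?r ^ 2 * (10 * ?r) ^ n)"
    using r10 by (intro summable_mult summable_geometric) auto
  have sn: "summable (\<lambda>n. norm (c (n + 2) * q ^ (n + 2)))"
    by (rule summable_comparison_test' [OF g]) (use b in auto)
  have s2: "summable (\<lambda>n. c (n + 2) * q ^ (n + 2))"
    using sn by (rule summable_norm_cancel)
  then have s: "summable (\<lambda>n. c n * q ^ n)"
    by (subst (asm) summable_iff_shift)
  have "(\<Sum>n. c n * q ^ n) - (c 0 + c 1 * q) = (\<Sum>n. c (n + 2) * q ^ (n + 2))"
    using suminf_split_initial_segment [OF s, of 2] by (simp add: eval_nat_numeral)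
  also have "norm \<dots> \<le> (\<Sum>n. norm (c (n + 2) * q ^ (n + 2)))"
    using sn by (rule summable_norm)
  also have "\<dots> \<le> (\<Sum>n. 3 ^ k * ?r ^ 2 * (10 * ?r) ^ n)"
    using b sn g by (rule suminf_le)
  also have "\<dots> = 3 ^ k * ?r ^ 2 * (1 / (1 - 10 * ?r))"
  proof -
    have "norm (10 * ?r) < 1" using r10 by simp
    then show ?thesis
      by (simp only: suminf_mult [OF summable_geometric] suminf_geometric)
  qed
  also have "\<dots> \<le> 3 ^ k * ?r ^ 2 * (23 / 22)"
  proof (intro mult_left_mono)
    have "1 / (1 - 10 * ?r) \<le> 1 / (22 / 23)"
      using r10 by (intro divide_left_mono) auto
    then show "1 / (1 - 10 * ?r) \<le> 23 / 22" by simp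
  qed auto
  finally show ?thesis by simp
qed

lemma norm_sigma5_shift_le:
  assumes "real m \<le> (real n + 3) ^ j" "j + 6 \<le> 8"
  shows "norm (of_nat m * of_nat (sigma5 (n + 3)) :: complex) \<le> 3 ^ (j + 6) * 10 ^ n"
proof -
  have "real (sigma5 (n + 3)) \<le> (real n + 3) ^ 6"
    using sigma5_le [of "n + 3"] by (metis of_nat_add of_nat_le_iff of_nat_numeral of_nat_power)
  then have "real m * real (sigma5 (n + 3)) \<le> (real n + 3) ^ j * (real n + 3) ^ 6"
    using assms(1) by (intro mult_mono) auto
  also have "\<dots> = (real n + 3) ^ (j + 6)" by (simp only: power_add)
  also have "\<dots> \<le> 3 ^ (j + 6) * 10 ^ n" using assms(2) by (rule plus3_power_le)
  finally show ?thesis by (simp add: norm_mult)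
qed

text \<open>Let \<open>D = q d/dq\<close>. Then \<open>q * sigma5_gf\<close> is the series of \<open>sigma5 n * q^n\<close>, \<open>q * sigma5_gf1\<close> is
  its image under \<open>D\<close>, and \<open>sigma5_gf_D\<close>, \<open>sigma5_gf1_D\<close> are the images of \<open>sigma5_gf\<close>, \<open>sigma5_gf1\<close>.\<close>

definition sigma5_gf :: "complex \<Rightarrow> complex" where
  "sigma5_gf \<tau> = (\<Sum>n. of_nat (sigma5 (Suc n)) * nome \<tau> ^ n)"
definition sigma5_gf1 :: "complex \<Rightarrow> complex" where
  "sigma5_gf1 \<tau> = (\<Sum>n. of_nat (Suc n) * of_nat (sigma5 (Suc n)) * nome \<tau> ^ n)"
definition sigma5_gf_D :: "complex \<Rightarrow> complex" where
  "sigma5_gf_D \<tau> = (\<Sum>n. of_nat n * of_nat (sigma5 (Suc n)) * nome \<tau> ^ n)"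
definition sigma5_gf1_D :: "complex \<Rightarrow> complex" where
  "sigma5_gf1_D \<tau> = (\<Sum>n. of_nat n * (of_nat (Suc n) * of_nat (sigma5 (Suc n))) * nome \<tau> ^ n)"

context
  fixes \<tau> :: complex
  assumes q: "norm (nome \<tau>) \<le> 1 / 230"
begin

text \<open>The linear part comes from sigma_5(1) = 1 and sigma_5(2) = 33. The constants 763, 2287
  and 6860 of this and the next three bounds are 3^k * 23/22 for k = 6, 7, 8, rounded up.\<close>

lemma sigma5_gf_bound: "norm (sigma5_gf \<tau> - (1 + 33 * nome \<tau>)) \<le> 763 * norm (nome \<tau>) ^ 2"
proof -
  have "norm (of_nat (sigma5 (Suc (n + 2))) :: complex) \<le> 3 ^ 6 * 10 ^ n" for n
    using norm_sigma5_shift_le [of 1 n 0] by (simp add: numeral_3_eq_3)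
  from powser_second_order_bound [OF this q]
  have "norm (sigma5_gf \<tau> - (1 + 33 * nome \<tau>)) \<le> 3 ^ 6 * 23 / 22 * norm (nome \<tau>) ^ 2"
    by (simp add: sigma5_gf_def flip: numeral_2_eq_2)
  also have "\<dots> \<le> 763 * norm (nome \<tau>) ^ 2" by (intro mult_right_mono) auto
  finally show ?thesis .
qed

lemma sigma5_gf1_bound: "norm (sigma5_gf1 \<tau> - (1 + 66 * nome \<tau>)) \<le> 2287 * norm (nome \<tau>) ^ 2"
proof -
  have "norm (of_nat (Suc (n + 2)) * of_nat (sigma5 (Suc (n + 2))) :: complex) \<le> 3 ^ 7 * 10 ^ n" for n
    using norm_sigma5_shift_le [of "n + 3" n 1] by (simp add: numeral_3_eq_3)
  from powser_second_order_bound [OF this q]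
  have "norm (sigma5_gf1 \<tau> - (1 + 66 * nome \<tau>)) \<le> 3 ^ 7 * 23 / 22 * norm (nome \<tau>) ^ 2"
    by (simp add: sigma5_gf1_def flip: numeral_2_eq_2)
  also have "\<dots> \<le> 2287 * norm (nome \<tau>) ^ 2" by (intro mult_right_mono) auto
  finally show ?thesis .
qed

lemma sigma5_gf_D_bound: "norm (sigma5_gf_D \<tau> - 33 * nome \<tau>) \<le> 2287 * norm (nome \<tau>) ^ 2"
proof -
  have "norm (of_nat (n + 2) * of_nat (sigma5 (Suc (n + 2))) :: complex) \<le> 3 ^ 7 * 10 ^ n" for n
    using norm_sigma5_shift_le [of "n + 2" n 1] by (simp add: numeral_3_eq_3)
  from powser_second_order_bound [OF this q]
  have "norm (sigma5_gf_D \<tau> - 33 * nome \<tau>) \<le> 3 ^ 7 * 23 / 22 * norm (nome \<tau>) ^ 2"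
    by (simp add: sigma5_gf_D_def flip: numeral_2_eq_2)
  also have "\<dots> \<le> 2287 * norm (nome \<tau>) ^ 2" by (intro mult_right_mono) auto
  finally show ?thesis .
qed

lemma sigma5_gf1_D_bound: "norm (sigma5_gf1_D \<tau> - 66 * nome \<tau>) \<le> 6860 * norm (nome \<tau>) ^ 2"
proof -
  have "norm (of_nat (n + 2) * (of_nat (Suc (n + 2)) * of_nat (sigma5 (Suc (n + 2)))) :: complex)
      \<le> 3 ^ 8 * 10 ^ n" for n
  proof -
    have "real ((n + 2) * (n + 3)) \<le> (real n + 3) ^ 2"
      by (simp add: power2_eq_square algebra_simps)
    from norm_sigma5_shift_le [OF this]
    have "norm (of_nat ((n + 2) * (n + 3)) * of_nat (sigma5 (n + 3)) :: complex) \<le> 3 ^ 8 * 10 ^ n"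
      by simp
    moreover have "Suc (n + 2) = n + 3" by simp
    ultimately show ?thesis by (simp only: of_nat_mult mult.assoc)
  qed
  from powser_second_order_bound [OF this q]
  have "norm (sigma5_gf1_D \<tau> - 66 * nome \<tau>) \<le> 3 ^ 8 * 23 / 22 * norm (nome \<tau>) ^ 2"
    by (simp add: sigma5_gf1_D_def flip: numeral_2_eq_2)
  also have "\<dots> \<le> 6860 * norm (nome \<tau>) ^ 2" by (intro mult_right_mono) auto
  finally show ?thesis .
qed

end

lemma suminf_nome_shift:
  fixes c :: "nat \<Rightarrow> complex"
  assumes "c 0 = 0" and "\<And>n. norm (c n) \<le> C * real n ^ k + D" and "Im \<tau> > 0"
  shows "(\<Sum>n. c n * nome \<tau> ^ n) = nome \<tau> * (\<Sum>n. c (Suc n) * nome \<tau> ^ n)"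
proof -
  have s: "summable (\<lambda>n. c n * nome \<tau> ^ n)"
    by (rule summable_norm_cancel, rule summable_norm_powser_poly_growth [OF assms(2)])
       (use assms(3) norm_nome_less_one in blast)
  then have "(\<Sum>n. c n * nome \<tau> ^ n) = (\<Sum>n. nome \<tau> * (c (Suc n) * nome \<tau> ^ n))"
    using suminf_split_head [OF s] assms(1) by (simp add: mult_ac)
  moreover have "summable (\<lambda>n. c (Suc n) * nome \<tau> ^ n)"
    using s nome_nonzero [of \<tau>] summable_Suc_iff [of "\<lambda>n. c n * nome \<tau> ^ n"]
      summable_mult_D [of "nome \<tau>" "\<lambda>n. c (Suc n) * nome \<tau> ^ n"]
    by (simp add: mult_ac)
  ultimately show ?thesis by (simp add: suminf_mult)
qed

lemma g3_eq_sigma5_gf: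
  assumes "Im \<tau> > 0"
  shows "g3 \<tau> = 280 * (of_real zeta6 - 8 * of_real pi ^ 6 / 15 * (nome \<tau> * sigma5_gf \<tau>))"
proof -
  have "(\<Sum>N. of_nat (sigma5 N) * nome \<tau> ^ N) = nome \<tau> * sigma5_gf \<tau>"
    unfolding sigma5_gf_def using norm_sigma5_le [of _ 0] assms
    by (intro suminf_nome_shift [where C = 1 and k = 6 and D = 0]) auto
  then show ?thesis using g3_q_expansion [OF assms] by simp
qed

lemma deriv_g3_eq_sigma5_gf1:
  assumes "Im \<tau> > 0"
  shows "deriv g3 \<tau> = - (896 * of_real pi ^ 7 / 3 * \<i> * (nome \<tau> * sigma5_gf1 \<tau>))"
proof -
  have "norm (of_nat n * of_nat (sigma5 n) :: complex) \<le> 1 * real n ^ 7 + 0" for n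
    using norm_sigma5_le [of n 1] by simp
  then have "(\<Sum>N. of_nat N * of_nat (sigma5 N) * nome \<tau> ^ N) = nome \<tau> * sigma5_gf1 \<tau>"
    unfolding sigma5_gf1_def using assms by (intro suminf_nome_shift [where C = 1 and k = 7 and D = 0]) auto
  then show ?thesis using deriv_g3 [OF assms] by simp
qed

lemma norm_sigma5_Suc_le: "norm (of_nat (sigma5 (Suc n)) :: complex) \<le> 64 * real n ^ 6 + 64"
proof -
  have "real (sigma5 (Suc n)) \<le> real (Suc n) ^ 6"
    using sigma5_le [of "Suc n"] by (metis of_nat_le_iff of_nat_power)
  also have "\<dots> \<le> 64 * real n ^ 6 + 64"
  proof (cases "n = 0")
    case False
    then have "real (Suc n) ^ 6 \<le> (2 * real n) ^ 6" by (intro power_mono) auto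
    then show ?thesis by (simp add: power_mult_distrib)
  qed simp
  finally show ?thesis by simp
qed

lemma norm_Suc_sigma5_Suc_le:
  "norm (of_nat (Suc n) * of_nat (sigma5 (Suc n)) :: complex) \<le> 128 * real n ^ 7 + 128"
proof -
  have "real (sigma5 (Suc n)) \<le> real (Suc n) ^ 6"
    using sigma5_le [of "Suc n"] by (metis of_nat_le_iff of_nat_power)
  then have "real (Suc n) * real (sigma5 (Suc n)) \<le> real (Suc n) ^ 7"
    by (simp add: power_Suc [of _ 6, simplified] mult_left_mono del: of_nat_Suc)
  also have "\<dots> \<le> 128 * real n ^ 7 + 128"
  proof (cases "n = 0")
    case False
    then have "real (Suc n) ^ 7 \<le> (2 * real n) ^ 7" by (intro power_mono) auto
    then show ?thesis by (simp add: power_mult_distrib)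
  qed simp
  finally show ?thesis by (simp add: norm_mult del: of_nat_Suc)
qed

lemma sigma5_gf_has_field_derivative:
  "Im \<tau> > 0 \<Longrightarrow> (sigma5_gf has_field_derivative 2 * of_real pi * \<i> * sigma5_gf_D \<tau>) (at \<tau>)"
  unfolding sigma5_gf_def [abs_def] sigma5_gf_D_def
  using norm_sigma5_Suc_le by (rule powser_nome_has_field_derivative)

lemma sigma5_gf1_has_field_derivative:
  "Im \<tau> > 0 \<Longrightarrow> (sigma5_gf1 has_field_derivative 2 * of_real pi * \<i> * sigma5_gf1_D \<tau>) (at \<tau>)"
  unfolding sigma5_gf1_def [abs_def] sigma5_gf1_D_def
  using norm_Suc_sigma5_Suc_le by (rule powser_nome_has_field_derivative)

text \<open>The coefficients are real, and conjugating q amounts to replacing \<tau> by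
  \<open>- cnj \<tau>\<close>.\<close>

lemma cnj_sigma5_gf1: "cnj (sigma5_gf1 \<tau>) = sigma5_gf1 (- cnj \<tau>)" if "Im \<tau> > 0"
proof -
  have s: "summable (\<lambda>n. of_nat (Suc n) * of_nat (sigma5 (Suc n)) * nome \<tau> ^ n)"
    by (rule summable_norm_cancel, rule summable_norm_powser_poly_growth [OF norm_Suc_sigma5_Suc_le])
       (use that norm_nome_less_one in blast)
  have "(\<lambda>n. cnj (of_nat (Suc n) * of_nat (sigma5 (Suc n)) * nome \<tau> ^ n)) sums cnj (sigma5_gf1 \<tau>)"
    unfolding sigma5_gf1_def sums_cnj by (rule summable_sums [OF s])
  then show ?thesis
    unfolding sigma5_gf1_def by (simp add: sums_iff cnj_nome del: of_nat_Suc)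
qed

section \<open>Numerical constants\<close>

text \<open>The lower bound keeps two terms. From the third term on n^6 \<ge> 81 n^2, so the tail is
  at most 1/81 of the tail of the sum of inverse squares, whose value is pi^2/6.\<close>

lemma zeta6_bounds: "(2539 / 2500) \<le> zeta6" "zeta6 \<le> (5103 / 5000)"
proof -
  let ?f = "\<lambda>n. 1 / (real n + 1) ^ 6"
  have z: "zeta6 = 1 + 1 / 64 + (\<Sum>n. ?f (n + 2))"
    unfolding zeta6_def using suminf_split_initial_segment [OF summable_zeta6, of 2]
    by (simp add: eval_nat_numeral)
  have s: "summable (\<lambda>n. ?f (n + 2))"
    using summable_zeta6 by (rule summable_ignore_initial_segment)
  then have "(\<Sum>n. ?f (n + 2)) \<ge> 0" by (rule suminf_nonneg) auto
  with z show "(2539 / 2500) \<le> zeta6" by simp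
  let ?g = "\<lambda>n::nat. 1 / (real n + 1) ^ 2"
  have sg: "summable ?g" "suminf ?g = pi ^ 2 / 6"
    using inverse_squares_sums by (simp_all add: sums_iff add_ac)
  have sg2: "summable (\<lambda>n. ?g (n + 2))"
    using sg(1) by (rule summable_ignore_initial_segment)
  have g: "(\<Sum>n. ?g (n + 2)) = pi ^ 2 / 6 - 1 - 1 / 4"
    using suminf_split_initial_segment [OF sg(1), of 2] sg(2) by (simp add: eval_nat_numeral)
  have "(\<Sum>n. ?f (n + 2)) \<le> (\<Sum>n. 1 / 81 * ?g (n + 2))"
  proof (rule suminf_le)
    fix n
    have "(3::real) ^ 4 \<le> (real (n + 2) + 1) ^ 4" by (intro power_mono) auto
    then have "(3::real) ^ 4 * (real (n + 2) + 1) ^ 2 \<le> (real (n + 2) + 1) ^ 4 * (real (n + 2) + 1) ^ 2"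
      by (intro mult_right_mono) auto
    also have "\<dots> = (real (n + 2) + 1) ^ 6" by (simp flip: power_add)
    finally have "1 / (real (n + 2) + 1) ^ 6 \<le> 1 / (3 ^ 4 * (real (n + 2) + 1) ^ 2)"
      by (intro divide_left_mono mult_pos_pos) auto
    then show "?f (n + 2) \<le> 1 / 81 * ?g (n + 2)" by simp
  qed (rule s, rule summable_mult [OF sg2])
  also have "\<dots> = 1 / 81 * (pi ^ 2 / 6 - 1 - 1 / 4)"
    using sg2 by (simp only: suminf_mult g)
  also have "\<dots> \<le> (49 / 10000)"
  proof -
    have "pi ^ 2 \<le> (3927 / 1250) ^ 2" using pi_approx by (intro power_mono) auto
    then show ?thesis by (simp add: power2_eq_square)
  qed
  finally show "zeta6 \<le> (5103 / 5000)" using z by simp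
qed

text \<open>The exact value is \<open>504\<close>, equivalent to \<open>zeta6 = pi^6 / 945\<close>; the bounds below suffice.\<close>

definition \<kappa> :: real where "\<kappa> = 8 * pi ^ 6 / (15 * zeta6)"
text \<open>The factor that accompanies \<tau> g3' when 6 g3 + \<tau> g3' is divided by 1680 zeta(6)
  q; its exact value is 168 pi.\<close>

definition \<mu> :: real where "\<mu> = pi * \<kappa> / 3"

lemma \<kappa>_bounds: "501 \<le> \<kappa>" "\<kappa> \<le> 505"
proof -
  have "(6283 / 2000) ^ 6 \<le> pi ^ 6" "pi ^ 6 \<le> (3927 / 1250) ^ 6"
    using pi_approx by (auto intro!: power_mono)
  then have p: "(4806 / 5) \<le> pi ^ 6" "pi ^ 6 \<le> (96141 / 100)"
    by (simp_all add: eval_nat_numeral)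
  have z: "0 < 15 * zeta6" using zeta6_bounds by simp
  show "501 \<le> \<kappa>" "\<kappa> \<le> 505"
    unfolding \<kappa>_def le_divide_eq divide_le_eq using z p zeta6_bounds by auto
qed

lemma \<mu>_bounds: "(1047 / 1000) * \<kappa> \<le> \<mu>" "\<mu> \<le> (1309 / 1250) * \<kappa>" "524 \<le> \<mu>" "\<mu> \<le> 529"
proof -
  have "(3141 / 1000) * \<kappa> \<le> pi * \<kappa>" "pi * \<kappa> \<le> (3927 / 1250) * \<kappa>"
    using pi_approx \<kappa>_bounds by (auto intro!: mult_right_mono)
  then show 1: "(1047 / 1000) * \<kappa> \<le> \<mu>" and 2: "\<mu> \<le> (1309 / 1250) * \<kappa>"
    unfolding \<mu>_def by linarith+
  show "524 \<le> \<mu>" using 1 \<kappa>_bounds by linarith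
  show "\<mu> \<le> 529" using 2 \<kappa>_bounds by linarith
qed

text \<open>Powers of e suffice: pi sqrt 3 is just above 136/25 = 5 + 4 * 11/100, and 2 pi * 47/50
  is just above 2953/500 = 6 - 2 * 47/1000. The small exponents are handled by the first Taylor
  terms.\<close>

lemma exp_pi_bounds: "230 \<le> exp (2 * pi * (sqrt 3 / 2))" "366 \<le> exp (2 * pi * (47 / 50))"
proof -
  have e: "(67957 / 25000) \<le> exp (1 :: real)"
    using abs_le_D2 [OF e_approx_32] by simp
  have "(22321 / 20000) \<le> exp ((11 / 100) :: real)"
    using exp_lower_Taylor_quadratic [of "(11 / 100) :: real"] by (simp add: power2_eq_square)
  then have "(67957 / 25000) ^ 5 * (22321 / 20000) ^ 4 \<le> exp (1 :: real) ^ 5 * exp ((11 / 100) :: real) ^ 4"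
    using e by (intro mult_mono power_mono) auto
  also have "\<dots> = exp ((136 / 25) :: real)"
    by (simp flip: exp_of_nat_mult exp_add)
  also have "\<dots> \<le> exp (2 * pi * (sqrt 3 / 2))"
  proof -
    have "(433 / 250) \<le> sqrt 3" by (rule real_le_rsqrt) (simp add: power2_eq_square)
    then have "(6283 / 2000) * (433 / 250) \<le> pi * sqrt 3" using pi_approx by (intro mult_mono) auto
    then show ?thesis by simp
  qed
  finally show "230 \<le> exp (2 * pi * (sqrt 3 / 2))" by (simp add: eval_nat_numeral)
  have "(953 / 1000) \<le> exp (- (47 / 1000) :: real)"
    using exp_ge_add_one_self [of "- (47 / 1000) :: real"] by simp
  then have "(67957 / 25000) ^ 6 * (953 / 1000) ^ 2 \<le> exp (1 :: real) ^ 6 * exp (- (47 / 1000) :: real) ^ 2"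
    using e by (intro mult_mono power_mono) auto
  also have "\<dots> = exp ((2953 / 500) :: real)"
    by (simp flip: exp_of_nat_mult exp_add)
  also have "\<dots> \<le> exp (2 * pi * (47 / 50))"
    using pi_approx by simp
  finally show "366 \<le> exp (2 * pi * (47 / 50))" by (simp add: eval_nat_numeral)
qed

lemma norm_nome_le_230:
  assumes "sqrt 3 / 2 \<le> Im \<tau>"
  shows "norm (nome \<tau>) \<le> 1 / 230"
proof -
  have "exp (2 * pi * (sqrt 3 / 2)) \<le> exp (2 * pi * Im \<tau>)"
    using assms by (subst exp_le_cancel_iff, intro mult_left_mono) auto
  then have "230 \<le> exp (2 * pi * Im \<tau>)" using exp_pi_bounds by linarith
  then show ?thesis
    unfolding norm_nome exp_minus by (subst inverse_eq_divide, intro divide_left_mono) auto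
qed

text \<open>The slope 2196 is 366 * 6, with 6 below 2 pi. Linear growth is enough, as the
  exponential is later set against quantities linear in the imaginary part.\<close>

lemma exp_2pi_ge:
  assumes "(47 / 50) \<le> y"
  shows "366 + 2196 * (y - (47 / 50)) \<le> exp (2 * pi * y)"
proof -
  have "366 * (1 + 6 * (y - (47 / 50))) \<le> exp (2 * pi * (47 / 50)) * exp (2 * pi * (y - (47 / 50)))"
  proof (intro mult_mono)
    have "6 * (y - (47 / 50)) \<le> 2 * pi * (y - (47 / 50))"
      using pi_approx assms by (intro mult_right_mono) auto
    then show "1 + 6 * (y - (47 / 50)) \<le> exp (2 * pi * (y - (47 / 50)))"
      using exp_ge_add_one_self [of "2 * pi * (y - (47 / 50))"] by linarith
  qed (use exp_pi_bounds assms in auto)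
  also have "\<dots> = exp (2 * pi * y)"
    by (simp flip: exp_add add: algebra_simps)
  finally show ?thesis by simp
qed

subsection \<open>Zeros of the quasimodular combination\<close>

text \<open>This is 6 g3 + \<tau> g3', into which the inversion carries g3' up to a power of \<tau>,
  divided by 1680 zeta(6) q. After the division the term 1/q has explicit modulus and
  argument.\<close>

definition quasi_g3 :: "complex \<Rightarrow> complex" where
  "quasi_g3 \<tau> = 1 / nome \<tau> - of_real \<kappa> * sigma5_gf \<tau> - of_real \<mu> * (\<i> * \<tau> * sigma5_gf1 \<tau>)"

lemma weight_6_derivative_eq_quasi_g3:
  assumes "Im \<tau> > 0"
  shows "6 * g3 \<tau> + \<tau> * deriv g3 \<tau> = 1680 * of_real zeta6 * nome \<tau> * quasi_g3 \<tau>"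
proof -
  have z: "zeta6 \<noteq> 0" using zeta6_bounds by auto
  have "8 * pi ^ 6 / 15 = zeta6 * \<kappa>"
    using z unfolding \<kappa>_def by simp
  then have k: "8 * of_real pi ^ 6 / 15 = (of_real zeta6 * of_real \<kappa> :: complex)"
    by (metis of_real_divide of_real_mult of_real_numeral of_real_power)
  have "896 * of_real pi ^ 7 / 3 = 560 * of_real pi * (8 * of_real pi ^ 6 / 15 :: complex)"
    by (simp add: eval_nat_numeral)
  also have "\<dots> = 1680 * of_real zeta6 * of_real \<mu>"
    unfolding k \<mu>_def by simp
  finally have m: "896 * of_real pi ^ 7 / 3 = (1680 * of_real zeta6 * of_real \<mu> :: complex)" .
  have alg: "6 * (280 * (c - c * k * (q * a))) + t * (- (1680 * c * m * \<i> * (q * b)))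
      = 1680 * c * q * (1 / q - k * a - m * (\<i> * t * b))" if "q \<noteq> 0" for a b c k m q t :: complex
    using that by (simp add: algebra_simps)
  show ?thesis
    unfolding g3_eq_sigma5_gf [OF assms] deriv_g3_eq_sigma5_gf1 [OF assms] k m quasi_g3_def
    using nome_nonzero by (rule alg)
qed

section \<open>Location of the zeros\<close>

text \<open>The third of \<open>F0\<close> around the cusp at infinity, cut off by the unit circles
  about 0 and 1, which meet at the centre exp (pi i / 3) of \<open>F0\<close>. It is a fundamental
  domain of the full modular group.\<close>

definition fund_triangle :: "complex set" where
  "fund_triangle = {\<tau>. Im \<tau> > 0 \<and> 0 \<le> Re \<tau> \<and> Re \<tau> \<le> 1 \<and> 1 \<le> norm \<tau> \<and> 1 \<le> norm (\<tau> - 1)}"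

lemma fund_triangleD:
  assumes "\<tau> \<in> fund_triangle"
  shows "0 < Im \<tau>" "0 \<le> Re \<tau>" "Re \<tau> \<le> 1" "1 \<le> (Re \<tau>)\<^sup>2 + (Im \<tau>)\<^sup>2" "1 \<le> (1 - Re \<tau>)\<^sup>2 + (Im \<tau>)\<^sup>2"
proof -
  have "1 \<le> (norm \<tau>)\<^sup>2" "1 \<le> (norm (\<tau> - 1))\<^sup>2"
    using assms by (simp_all add: fund_triangle_def)
  then show "1 \<le> (Re \<tau>)\<^sup>2 + (Im \<tau>)\<^sup>2" "1 \<le> (1 - Re \<tau>)\<^sup>2 + (Im \<tau>)\<^sup>2"
    by (simp_all add: cmod_power2 power2_commute)
qed (use assms in \<open>auto simp: fund_triangle_def\<close>)

text \<open>The lowest point is exp (pi i / 3): the circle about the nearer of 0 and 1 gives (Im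
  \<tau>)^2 \<ge> 1 - 1/4.\<close>

lemma fund_triangle_Im_ge:
  assumes "\<tau> \<in> fund_triangle"
  shows "sqrt 3 / 2 \<le> Im \<tau>"
proof -
  have "3 / 4 \<le> (Im \<tau>)\<^sup>2"
  proof (cases "Re \<tau> \<le> 1 / 2")
    case True
    then have "(Re \<tau>)\<^sup>2 \<le> (1 / 2)\<^sup>2" using fund_triangleD [OF assms] by (intro power_mono) auto
    then show ?thesis using fund_triangleD [OF assms] by (simp add: power2_eq_square)
  next
    case False
    then have "(1 - Re \<tau>)\<^sup>2 \<le> (1 / 2)\<^sup>2" using fund_triangleD [OF assms] by (intro power_mono) auto
    then show ?thesis using fund_triangleD [OF assms] by (simp add: power2_eq_square)
  qed
  then have "sqrt 3 \<le> 2 * Im \<tau>"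
    using fund_triangleD [OF assms] by (intro real_le_lsqrt) (auto simp: power_mult_distrib)
  then show ?thesis by simp
qed

lemma Re_nome: "Re (nome \<tau>) = norm (nome \<tau>) * cos (2 * pi * Re \<tau>)"
  and Im_nome: "Im (nome \<tau>) = norm (nome \<tau>) * sin (2 * pi * Re \<tau>)"
  by (simp_all add: nome_def Re_exp Im_exp)

lemma inverse_nome: "1 / nome \<tau> = nome (- \<tau>)"
  by (simp add: nome_def exp_minus divide_inverse)

lemma Re_inverse_nome: "Re (1 / nome \<tau>) = exp (2 * pi * Im \<tau>) * cos (2 * pi * Re \<tau>)"
  and Im_inverse_nome: "Im (1 / nome \<tau>) = - (exp (2 * pi * Im \<tau>) * sin (2 * pi * Re \<tau>))"
  unfolding inverse_nome by (simp_all add: Re_nome Im_nome norm_nome)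

lemma minus_mult_abs_le: "0 \<le> m \<Longrightarrow> - (m * \<bar>t\<bar>) \<le> m * t" for m t :: real
  using mult_left_mono [OF abs_ge_minus_self [of t], of m] by simp

text \<open>Below height 47/50 the two circles leave only 1/3 \<le> Re \<tau> \<le> 2/3, where cos
  (2 pi Re \<tau>) \<le> -1/2. Then Re (1/q) \<le> -115, too negative for the other terms of
  \<open>quasi_g3\<close> to balance.\<close>

lemma quasi_g3_zero_Im_ge:
  assumes "\<tau> \<in> fund_triangle" "quasi_g3 \<tau> = 0"
  shows "47 / 50 \<le> Im \<tau>"
proof (rule ccontr)
  assume "\<not> 47 / 50 \<le> Im \<tau>"
  define x y where "x = Re \<tau>" and "y = Im \<tau>"
  note F = fund_triangleD [OF assms(1), folded x_def y_def]
  have y: "1 / 2 \<le> y" "y < 47 / 50"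
  proof -
    have "1 \<le> sqrt 3" by simp
    then show "1 / 2 \<le> y" using fund_triangle_Im_ge [OF assms(1)] unfolding y_def by linarith
  qed (use \<open>\<not> 47 / 50 \<le> Im \<tau>\<close> in \<open>simp add: y_def\<close>)
  have y2: "y\<^sup>2 \<le> (47 / 50)\<^sup>2" using y by (intro power_mono) auto
  \<comment> \<open>Here 1 - (47/50)^2 = 291/2500 is just above 1/9, which yields the bounds 1/3 and
    2/3 for x.\<close>
  then have x1: "291 / 2500 \<le> x\<^sup>2" "291 / 2500 \<le> (1 - x)\<^sup>2"
    using F by (simp_all add: power2_eq_square)
  have x: "1 / 3 \<le> x" "x \<le> 2 / 3"
  proof -
    show "1 / 3 \<le> x"
    proof (rule ccontr)
      assume "\<not> 1 / 3 \<le> x"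
      then have "x\<^sup>2 \<le> (1 / 3)\<^sup>2" using F by (intro power_mono) auto
      with x1 show False by (simp add: power2_eq_square)
    qed
    show "x \<le> 2 / 3"
    proof (rule ccontr)
      assume "\<not> x \<le> 2 / 3"
      then have "(1 - x)\<^sup>2 \<le> (1 / 3)\<^sup>2" using F by (intro power_mono) auto
      with x1 show False by (simp add: power2_eq_square)
    qed
  qed
  have cos: "cos (2 * pi * x) \<le> - 1 / 2"
  proof -
    have "\<bar>2 * pi * x - pi\<bar> \<le> pi / 3"
    proof -
      have "pi * (1 / 3) \<le> pi * x" "pi * x \<le> pi * (2 / 3)"
        using x by (auto intro!: mult_left_mono)
      then show ?thesis by linarith
    qed
    then have "cos (pi / 3) \<le> cos \<bar>2 * pi * x - pi\<bar>"
      by - (rule cos_monotone_0_pi_le; simp)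
    then show ?thesis by (simp add: cos_60 cos_diff)
  qed
  define r where "r = norm (nome \<tau>)"
  define u v where "u = Re (nome \<tau>)" and "v = Im (nome \<tau>)"
  define a b where "a = sigma5_gf \<tau> - (1 + 33 * nome \<tau>)" and "b = sigma5_gf1 \<tau> - (1 + 66 * nome \<tau>)"
  have r: "0 < r" "r \<le> 1 / 230"
    using nome_nonzero norm_nome_le_230 [OF fund_triangle_Im_ge [OF assms(1)]] by (auto simp: r_def)
  have r2: "r\<^sup>2 \<le> 1 / 52900"
    using power_mono [OF r(2), of 2] r by (simp add: power2_eq_square)
  have "u = r * cos (2 * pi * x)" by (simp add: u_def r_def x_def Re_nome)
  then have u: "u \<le> - r / 2"
    using mult_left_mono [OF cos, of r] r by simp
  have t: "Re (1 / nome \<tau>) \<le> - 115"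
  proof -
    have e: "230 \<le> exp (2 * pi * y)"
      using r(2) unfolding r_def norm_nome exp_minus y_def by (simp add: field_simps)
    then have "exp (2 * pi * y) * cos (2 * pi * x) \<le> exp (2 * pi * y) * (- 1 / 2)"
      using cos by (intro mult_left_mono) auto
    then show ?thesis using e unfolding Re_inverse_nome x_def y_def by simp
  qed
  have "1 / nome \<tau> = of_real \<kappa> * (1 + 33 * nome \<tau> + a)
      + of_real \<mu> * (\<i> * \<tau> + 66 * (\<i> * \<tau> * nome \<tau>) + \<i> * \<tau> * b)"
    using assms(2) by (simp add: quasi_g3_def a_def b_def algebra_simps)
  then have eq: "Re (1 / nome \<tau>) = \<kappa> * (1 + 33 * u + Re a)
      + \<mu> * (- y + 66 * (- (x * v) - y * u) + Re (\<i> * \<tau> * b))"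
    by (simp add: u_def v_def x_def y_def algebra_simps)
  have t2: "0 \<le> \<kappa> - \<mu> * y"
  proof -
    have "\<mu> * y \<le> \<mu> * (47 / 50)" using y \<mu>_bounds by (intro mult_left_mono) auto
    then show ?thesis using \<mu>_bounds \<kappa>_bounds by linarith
  qed
  have t3: "0 \<le> u * (33 * \<kappa> - 66 * (\<mu> * y))"
  proof (rule mult_nonpos_nonpos)
    show "u \<le> 0" using u r by simp
    have "\<mu> * (1 / 2) \<le> \<mu> * y" using y \<mu>_bounds by (intro mult_left_mono) auto
    then show "33 * \<kappa> - 66 * (\<mu> * y) \<le> 0" using \<mu>_bounds \<kappa>_bounds by linarith
  qed
  \<comment> \<open>The sign of v is that of sin (2 pi x), so v > 0 forces x \<le> 1/2 and x v \<le>
    1/2 * 1/230.\<close>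
  have t4: "\<mu> * (x * v) \<le> 529 * (1 / 460)"
  proof (cases "v \<le> 0")
    case True
    then have "\<mu> * (x * v) \<le> 0"
      using \<mu>_bounds x by (simp add: mult_nonneg_nonpos)
    then show ?thesis by simp
  next
    case False
    have "x \<le> 1 / 2"
    proof (rule ccontr)
      assume *: "\<not> x \<le> 1 / 2"
      have "0 \<le> sin (2 * pi * x - pi)"
      proof (rule sin_ge_zero)
        have "pi * (1 / 2) \<le> pi * x" "pi * x \<le> pi * 1"
          using * F by (auto intro!: mult_left_mono)
        then show "0 \<le> 2 * pi * x - pi" "2 * pi * x - pi \<le> pi" by linarith+
      qed
      then have "sin (2 * pi * x) \<le> 0" by (simp add: sin_diff)
      moreover have "v = r * sin (2 * pi * x)" by (simp add: v_def r_def x_def Im_nome)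
      ultimately have "v \<le> 0" using r by (simp add: mult_nonneg_nonpos)
      with False show False by simp
    qed
    moreover have "v \<le> 1 / 230"
      using abs_Im_le_cmod [of "nome \<tau>"] r by (simp add: v_def r_def)
    ultimately have "x * v \<le> 1 / 2 * (1 / 230)" using False x by (intro mult_mono) auto
    then have "\<mu> * (x * v) \<le> 529 * (1 / 2 * (1 / 230))"
      by (rule mult_mono [rotated]) (use \<mu>_bounds False x in auto)
    then show ?thesis by simp
  qed
  have t5: "- (505 * (763 * (1 / 52900))) \<le> \<kappa> * Re a"
  proof -
    have "norm a \<le> 763 * r\<^sup>2"
      using sigma5_gf_bound r by (simp add: a_def r_def)
    then have "\<bar>Re a\<bar> \<le> 763 * (1 / 52900)"
      using abs_Re_le_cmod [of a] r2 by linarith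
    then have "\<kappa> * \<bar>Re a\<bar> \<le> 505 * (763 * (1 / 52900))"
      using \<kappa>_bounds by (intro mult_mono) auto
    moreover have "\<kappa> * Re a \<ge> - (\<kappa> * \<bar>Re a\<bar>)"
      by (rule minus_mult_abs_le) (use \<kappa>_bounds in simp)
    ultimately show ?thesis by linarith
  qed
  have t6: "- (529 * (6 / 5 * (2287 * (1 / 52900)))) \<le> \<mu> * Re (\<i> * \<tau> * b)"
  proof -
    have nb: "norm b \<le> 2287 * (1 / 52900)"
      using sigma5_gf1_bound r r2 by (force simp add: b_def r_def)
    have "(norm \<tau>)\<^sup>2 \<le> (6 / 5)\<^sup>2"
    proof -
      have "x\<^sup>2 \<le> (2 / 3)\<^sup>2" using x by (intro power_mono) auto
      with y2 show ?thesis
        unfolding cmod_power2 x_def y_def by (simp add: power2_eq_square)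
    qed
    then have nt: "norm \<tau> \<le> 6 / 5" by (rule power2_le_imp_le) simp
    have "\<bar>Re (\<i> * \<tau> * b)\<bar> \<le> norm \<tau> * norm b"
      using abs_Re_le_cmod [of "\<i> * \<tau> * b"] by (simp add: norm_mult)
    also have "\<dots> \<le> 6 / 5 * (2287 * (1 / 52900))"
      using nb nt by (intro mult_mono) auto
    finally have "\<mu> * \<bar>Re (\<i> * \<tau> * b)\<bar> \<le> 529 * (6 / 5 * (2287 * (1 / 52900)))"
      using \<mu>_bounds by (intro mult_mono) auto
    moreover have "\<mu> * Re (\<i> * \<tau> * b) \<ge> - (\<mu> * \<bar>Re (\<i> * \<tau> * b)\<bar>)"
      by (rule minus_mult_abs_le) (use \<mu>_bounds in simp)
    ultimately show ?thesis by linarith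
  qed
  \<comment> \<open>The first two terms are nonnegative and the last three add up to more than -111,
    against at most -115 on the left.\<close>
  have "Re (1 / nome \<tau>) = (\<kappa> - \<mu> * y) + u * (33 * \<kappa> - 66 * (\<mu> * y)) - 66 * (\<mu> * (x * v))
      + \<kappa> * Re a + \<mu> * Re (\<i> * \<tau> * b)"
    unfolding eq by (simp add: algebra_simps)
  with t t2 t3 t4 t5 t6 show False by linarith
qed

section \<open>Zeros at height at least 47/50\<close>

context
  fixes \<tau> :: complex
  assumes y: "47 / 50 \<le> Im \<tau>" and x: "0 \<le> Re \<tau>" "Re \<tau> \<le> 1"
begin

lemma exp_2pi_Im_ge: "366 \<le> exp (2 * pi * Im \<tau>)"
  using exp_2pi_ge [OF y] y by simp

lemma norm_nome_le_366: "norm (nome \<tau>) \<le> 1 / 366"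
  using exp_2pi_Im_ge unfolding norm_nome exp_minus by (simp add: field_simps)

lemma norm_nome_le_230': "norm (nome \<tau>) \<le> 1 / 230"
  using norm_nome_le_366 by simp

lemma norm_nome_square_le_366: "norm (nome \<tau>) ^ 2 \<le> 1 / 366 * (1 / 366)"
  unfolding power2_eq_square using norm_nome_le_366 by (intro mult_mono) auto

text \<open>Since 0 \<le> Re \<tau> \<le> 1 and Im \<tau> \<ge> 47/50, |\<tau>| is at most 1.47 Im
  \<tau>, which the exponential outgrows. Pairing \<tau> with q keeps later bounds uniform, as
  |\<tau>| alone is unbounded.\<close>

lemma norm_mult_nome_le: "norm \<tau> * norm (nome \<tau>) \<le> 189 / 50000"
proof -
  have "(norm \<tau>)\<^sup>2 \<le> (147 / 100 * Im \<tau>)\<^sup>2"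
  proof -
    have "(Re \<tau>)\<^sup>2 \<le> 1\<^sup>2" using x by (intro power_mono) auto
    moreover have "(47 / 50)\<^sup>2 \<le> (Im \<tau>)\<^sup>2" using y by (intro power_mono) auto
    ultimately show ?thesis
      unfolding cmod_power2 power_mult_distrib by (simp add: power2_eq_square)
  qed
  then have "norm \<tau> \<le> 147 / 100 * Im \<tau>"
    using y by (intro power2_le_imp_le [of "norm \<tau>"]) auto
  also have "\<dots> \<le> 189 / 50000 * exp (2 * pi * Im \<tau>)"
    using exp_2pi_ge [OF y] y by (simp add: field_simps)
  finally show ?thesis
    unfolding norm_nome exp_minus by (simp add: field_simps)
qed

text \<open>At a zero of \<open>quasi_g3\<close> this is the error made in 1/q when both series are
  replaced by their constant term 1. The two summands contribute 48.5 and 144.5.\<close>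

lemma quasi_g3_residual_le:
  "norm (of_real \<kappa> * (sigma5_gf \<tau> - 1) + of_real \<mu> * (\<i> * \<tau> * (sigma5_gf1 \<tau> - 1))) \<le> 193"
proof -
  define r where "r = norm (nome \<tau>)"
  have r: "0 \<le> r" "r \<le> 1 / 366" "r\<^sup>2 \<le> 1 / 366 * (1 / 366)"
    using norm_nome_le_366 norm_nome_square_le_366 by (auto simp: r_def)
  have "norm (sigma5_gf \<tau> - 1) \<le> norm (sigma5_gf \<tau> - (1 + 33 * nome \<tau>)) + norm (33 * nome \<tau>)"
    using norm_triangle_ineq [of "sigma5_gf \<tau> - (1 + 33 * nome \<tau>)" "33 * nome \<tau>"] by simp
  also have "\<dots> \<le> 763 * r\<^sup>2 + 33 * r"
    using sigma5_gf_bound [OF norm_nome_le_230'] by (simp add: norm_mult r_def)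
  also have "\<dots> \<le> 763 * (1 / 366 * (1 / 366)) + 33 * (1 / 366)"
    using r by (intro add_mono mult_left_mono) auto
  finally have "\<kappa> * norm (sigma5_gf \<tau> - 1) \<le> 505 * (763 * (1 / 366 * (1 / 366)) + 33 * (1 / 366))"
    using \<kappa>_bounds by (intro mult_mono) auto
  then have 1: "norm (of_real \<kappa> * (sigma5_gf \<tau> - 1)) \<le> 485 / 10"
    using \<kappa>_bounds by (simp add: norm_mult)
  have "norm (sigma5_gf1 \<tau> - 1) \<le> norm (sigma5_gf1 \<tau> - (1 + 66 * nome \<tau>)) + norm (66 * nome \<tau>)"
    using norm_triangle_ineq [of "sigma5_gf1 \<tau> - (1 + 66 * nome \<tau>)" "66 * nome \<tau>"] by simp
  also have "\<dots> \<le> 2287 * r\<^sup>2 + 66 * r"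
    using sigma5_gf1_bound [OF norm_nome_le_230'] by (simp add: norm_mult r_def)
  also have "\<dots> = r * (2287 * r + 66)" by (simp add: power2_eq_square algebra_simps)
  finally have "norm \<tau> * norm (sigma5_gf1 \<tau> - 1) \<le> norm \<tau> * (r * (2287 * r + 66))"
    by (intro mult_left_mono) auto
  also have "\<dots> = (norm \<tau> * r) * (2287 * r + 66)" by simp
  also have "\<dots> \<le> 189 / 50000 * (2287 * (1 / 366) + 66)"
    using r norm_mult_nome_le by (intro mult_mono) (auto simp: r_def)
  finally have "\<mu> * (norm \<tau> * norm (sigma5_gf1 \<tau> - 1)) \<le> 529 * (189 / 50000 * (2287 * (1 / 366) + 66))"
    by (rule mult_mono [rotated]) (use \<mu>_bounds in auto)
  then have 2: "norm (of_real \<mu> * (\<i> * \<tau> * (sigma5_gf1 \<tau> - 1))) \<le> 1445 / 10"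
    using \<mu>_bounds by (simp add: norm_mult)
  show ?thesis
    using norm_triangle_ineq [of "of_real \<kappa> * (sigma5_gf \<tau> - 1)" "of_real \<mu> * (\<i> * \<tau> * (sigma5_gf1 \<tau> - 1))"] 1 2
    by linarith
qed

text \<open>Compare real and imaginary parts in 1/q = \<kappa> + i \<mu> \<tau> + E with |E| \<le>
  193. The real part is small against |1/q|, so the sine of 2 pi Re \<tau> is at least 0.71 in
  absolute value; the imaginary part rules out a positive sine.\<close>

lemma quasi_g3_zero_Re_bounds:
  assumes "quasi_g3 \<tau> = 0"
  shows "5 / 8 \<le> Re \<tau>" "Re \<tau> \<le> 7 / 8"
proof -
  define E where "E = of_real \<kappa> * (sigma5_gf \<tau> - 1) + of_real \<mu> * (\<i> * \<tau> * (sigma5_gf1 \<tau> - 1))"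
  define R where "R = exp (2 * pi * Im \<tau>)"
  define c s where "c = cos (2 * pi * Re \<tau>)" and "s = sin (2 * pi * Re \<tau>)"
  have R: "2196 * Im \<tau> - 1699 \<le> R" "366 \<le> R"
    using exp_2pi_ge [OF y] exp_2pi_Im_ge by (auto simp: R_def)
  have "norm E \<le> 193" using quasi_g3_residual_le by (simp add: E_def)
  then have E: "Re E \<le> 193" "- 193 \<le> Re E" "- 193 \<le> Im E"
    using abs_Re_le_cmod [of E] abs_Im_le_cmod [of E] by linarith+
  have eq: "1 / nome \<tau> = of_real \<kappa> + of_real \<mu> * (\<i> * \<tau>) + E"
    using assms by (simp add: quasi_g3_def E_def algebra_simps)
  define w p where "w = \<mu> * Im \<tau>" and "p = R * c"
  have re: "p = \<kappa> - w + Re E"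
    using arg_cong [OF eq, of Re] unfolding Re_inverse_nome by (simp add: R_def c_def w_def p_def)
  have im: "- (R * s) = \<mu> * Re \<tau> + Im E"
    using arg_cong [OF eq, of Im] unfolding Im_inverse_nome by (simp add: R_def s_def)
  have m1: "w \<le> 529 * Im \<tau>"
    unfolding w_def using \<mu>_bounds y by (intro mult_right_mono) auto
  have m2: "524 * (47 / 50) \<le> w"
    unfolding w_def by (rule mult_mono) (use \<mu>_bounds y in auto)
  \<comment> \<open>Near height 47/50 the terms \<kappa> and w nearly cancel; higher up R grows
    faster than w.\<close>
  have "\<bar>p\<bar> \<le> 7 / 10 * R"
    using re E m1 m2 R \<kappa>_bounds y by linarith
  then have "\<bar>c\<bar> \<le> 7 / 10"
    using R by (simp add: p_def abs_mult)
  then have "c\<^sup>2 \<le> (7 / 10)\<^sup>2"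
    by (rule power2_le_iff_abs_le [THEN iffD2, rotated]) simp
  moreover have "c\<^sup>2 + s\<^sup>2 = 1" by (simp add: c_def s_def)
  \<comment> \<open>The value 51/100 exceeds (71/100)^2, and 71/100 exceeds sin (pi / 4).\<close>
  ultimately have s2: "51 / 100 \<le> s\<^sup>2" by (simp add: power2_eq_square)
  have s: "s \<le> - 71 / 100"
  proof (rule ccontr)
    assume *: "\<not> s \<le> - 71 / 100"
    have "71 / 100 \<le> s"
    proof (rule ccontr)
      assume "\<not> 71 / 100 \<le> s"
      with * have "\<bar>s\<bar> \<le> 71 / 100" by auto
      then have "s\<^sup>2 \<le> (71 / 100)\<^sup>2"
        by (rule power2_le_iff_abs_le [THEN iffD2, rotated]) simp
      with s2 show False by (simp add: power2_eq_square)
    qed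
    then have "366 * (71 / 100) \<le> R * s" using R by (intro mult_mono) auto
    moreover have "0 \<le> \<mu> * Re \<tau>" using \<mu>_bounds x by simp
    ultimately show False using im E by linarith
  qed
  have q2: "sqrt 2 / 2 < 71 / 100"
  proof -
    have "sqrt 2 < 142 / 100" by (rule real_less_lsqrt) (auto simp: power2_eq_square)
    then show ?thesis by simp
  qed
  have p: "2 * pi * Re \<tau> \<le> pi" if "Re \<tau> \<le> 1 / 2"
    using mult_left_mono [OF that, of "2 * pi"] by simp
  show "5 / 8 \<le> Re \<tau>"
  proof (rule ccontr)
    assume *: "\<not> 5 / 8 \<le> Re \<tau>"
    show False
    proof (cases "Re \<tau> \<le> 1 / 2")
      case True
      then have "0 \<le> s" unfolding s_def using x p by (intro sin_ge_zero) auto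
      with s show False by simp
    next
      case False
      have "pi * (1 / 2) \<le> pi * Re \<tau>" "pi * Re \<tau> \<le> pi * (5 / 8)"
        using False * by (auto intro!: mult_left_mono)
      then have "sin (2 * pi * Re \<tau> - pi) \<le> sin (pi / 4)"
        by - (rule sin_monotone_2pi_le; linarith)
      then have "- s \<le> sqrt 2 / 2" by (simp add: s_def sin_diff sin_45)
      with s q2 show False by simp
    qed
  qed
  show "Re \<tau> \<le> 7 / 8"
  proof (rule ccontr)
    assume *: "\<not> Re \<tau> \<le> 7 / 8"
    have "pi * (7 / 8) \<le> pi * Re \<tau>" "pi * Re \<tau> \<le> pi * 1"
      using x * by (auto intro!: mult_left_mono)
    then have "sin (2 * pi - 2 * pi * Re \<tau>) \<le> sin (pi / 4)"
      by - (rule sin_monotone_2pi_le; linarith)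
    then have "- s \<le> sqrt 2 / 2" by (simp add: s_def sin_diff sin_45)
    with s q2 show False by simp
  qed
qed

end

lemma sin_le_sector:
  assumes "5 / 8 \<le> x" "x \<le> 7 / 8"
  shows "sin (2 * pi * x) \<le> - 7 / 10"
proof -
  have "pi * (5 / 8) \<le> pi * x" "pi * x \<le> pi * (7 / 8)"
    using assms by (auto intro!: mult_left_mono)
  then have "\<bar>2 * pi * x - 3 / 2 * pi\<bar> \<le> pi / 4" by linarith
  then have "cos (pi / 4) \<le> cos \<bar>2 * pi * x - 3 / 2 * pi\<bar>"
    by - (rule cos_monotone_0_pi_le; simp)
  moreover have "7 / 5 \<le> sqrt 2" by (rule real_le_rsqrt) (simp add: power2_eq_square)
  moreover have "cos (2 * pi * x - 3 / 2 * pi) = - sin (2 * pi * x)"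
    by (simp only: cos_diff cos_3over2_pi sin_3over2_pi)
  ultimately show ?thesis by (simp add: cos_45)
qed

text \<open>The derivative of 1/q contributes 2 pi Im (1/q) to the real part, and Im (1/q) \<ge> 366
  * 7/10 > 256 here. Up to the same factor 2 pi the remaining terms are at least -(55 + 170 + 100/6)
  > -242.\<close>

lemma quasi_g3_has_field_derivative:
  assumes "47 / 50 \<le> Im \<tau>" "5 / 8 \<le> Re \<tau>" "Re \<tau> \<le> 7 / 8"
  obtains G' where "(quasi_g3 has_field_derivative G') (at \<tau>)" "Re G' > 0"
proof
  let ?G' = "- (2 * of_real pi * \<i> * (1 / nome \<tau>)) - of_real \<kappa> * (2 * of_real pi * \<i> * sigma5_gf_D \<tau>)
     - of_real \<mu> * (\<i> * sigma5_gf1 \<tau> + \<i> * \<tau> * (2 * of_real pi * \<i> * sigma5_gf1_D \<tau>))"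
  have im: "Im \<tau> > 0" using assms by simp
  show "(quasi_g3 has_field_derivative ?G') (at \<tau>)"
    unfolding quasi_g3_def [abs_def]
    by (rule derivative_eq_intros nome_has_field_derivative sigma5_gf_has_field_derivative [OF im]
          sigma5_gf1_has_field_derivative [OF im] nome_nonzero refl)+
       (use nome_nonzero [of \<tau>] in \<open>simp add: field_simps\<close>)
  have x: "0 \<le> Re \<tau>" "Re \<tau> \<le> 1" using assms by auto
  note q = norm_nome_le_230' [OF assms(1) x]
  define r where "r = norm (nome \<tau>)"
  have r: "0 \<le> r" "r \<le> 1 / 366" "r\<^sup>2 \<le> 1 / 366 * (1 / 366)"
    using norm_nome_le_366 [OF assms(1) x] norm_nome_square_le_366 [OF assms(1) x] by (auto simp: r_def)
  define S where "S = Im (1 / nome \<tau>)"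
  have S: "366 * (7 / 10) \<le> S"
  proof -
    have "366 * (7 / 10) \<le> exp (2 * pi * Im \<tau>) * (- sin (2 * pi * Re \<tau>))"
      by (rule mult_mono) (use exp_2pi_Im_ge [OF assms(1) x] sin_le_sector [OF assms(2,3)] in auto)
    then show ?thesis unfolding S_def Im_inverse_nome by simp
  qed
  have a: "- 55 \<le> \<kappa> * Im (sigma5_gf_D \<tau>)"
  proof -
    have "norm (sigma5_gf_D \<tau>) \<le> norm (sigma5_gf_D \<tau> - 33 * nome \<tau>) + norm (33 * nome \<tau>)"
      using norm_triangle_ineq [of "sigma5_gf_D \<tau> - 33 * nome \<tau>" "33 * nome \<tau>"] by simp
    also have "\<dots> \<le> 2287 * r\<^sup>2 + 33 * r"
      using sigma5_gf_D_bound [OF q] by (simp add: norm_mult r_def)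
    also have "\<dots> \<le> 2287 * (1 / 366 * (1 / 366)) + 33 * (1 / 366)"
      using r by (intro add_mono mult_left_mono) auto
    finally have "\<kappa> * \<bar>Im (sigma5_gf_D \<tau>)\<bar> \<le> 505 * (2287 * (1 / 366 * (1 / 366)) + 33 * (1 / 366))"
      using abs_Im_le_cmod [of "sigma5_gf_D \<tau>"] \<kappa>_bounds by (intro mult_mono) linarith+
    also have "\<dots> \<le> 55" by simp
    finally have "\<kappa> * \<bar>Im (sigma5_gf_D \<tau>)\<bar> \<le> 55" .
    moreover have "- (\<kappa> * \<bar>Im (sigma5_gf_D \<tau>)\<bar>) \<le> \<kappa> * Im (sigma5_gf_D \<tau>)"
      by (rule minus_mult_abs_le) (use \<kappa>_bounds in simp)
    ultimately show ?thesis by linarith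
  qed
  have b: "- 100 \<le> \<kappa> * Im (sigma5_gf1 \<tau>)"
  proof -
    have "Im (sigma5_gf1 \<tau>) = Im (sigma5_gf1 \<tau> - (1 + 66 * nome \<tau>)) + Im (66 * nome \<tau>)" by simp
    then have "\<bar>Im (sigma5_gf1 \<tau>)\<bar> \<le> norm (sigma5_gf1 \<tau> - (1 + 66 * nome \<tau>)) + norm (66 * nome \<tau>)"
      using abs_Im_le_cmod [of "sigma5_gf1 \<tau> - (1 + 66 * nome \<tau>)"] abs_Im_le_cmod [of "66 * nome \<tau>"] by linarith
    also have "\<dots> \<le> 2287 * r\<^sup>2 + 66 * r"
      using sigma5_gf1_bound [OF q] by (simp add: norm_mult r_def)
    also have "\<dots> \<le> 2287 * (1 / 366 * (1 / 366)) + 66 * (1 / 366)"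
      using r by (intro add_mono mult_left_mono) auto
    finally have "\<kappa> * \<bar>Im (sigma5_gf1 \<tau>)\<bar> \<le> 505 * (2287 * (1 / 366 * (1 / 366)) + 66 * (1 / 366))"
      using \<kappa>_bounds by (intro mult_mono) linarith+
    also have "\<dots> \<le> 100" by simp
    finally have "\<kappa> * \<bar>Im (sigma5_gf1 \<tau>)\<bar> \<le> 100" .
    moreover have "- (\<kappa> * \<bar>Im (sigma5_gf1 \<tau>)\<bar>) \<le> \<kappa> * Im (sigma5_gf1 \<tau>)"
      by (rule minus_mult_abs_le) (use \<kappa>_bounds in simp)
    ultimately show ?thesis by linarith
  qed
  have d: "- 170 \<le> \<mu> * Im (\<i> * \<tau> * sigma5_gf1_D \<tau>)"
  proof -
    have "norm (sigma5_gf1_D \<tau>) \<le> norm (sigma5_gf1_D \<tau> - 66 * nome \<tau>) + norm (66 * nome \<tau>)"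
      using norm_triangle_ineq [of "sigma5_gf1_D \<tau> - 66 * nome \<tau>" "66 * nome \<tau>"] by simp
    also have "\<dots> \<le> 6860 * r\<^sup>2 + 66 * r"
      using sigma5_gf1_D_bound [OF q] by (simp add: norm_mult r_def)
    also have "\<dots> = r * (6860 * r + 66)" by (simp add: power2_eq_square algebra_simps)
    finally have "norm \<tau> * norm (sigma5_gf1_D \<tau>) \<le> norm \<tau> * (r * (6860 * r + 66))"
      by (intro mult_left_mono) auto
    also have "\<dots> = (norm \<tau> * r) * (6860 * r + 66)" by simp
    also have "\<dots> \<le> 189 / 50000 * (6860 * (1 / 366) + 66)"
      using r norm_mult_nome_le [OF assms(1) x] by (intro mult_mono) (auto simp: r_def)
    finally have "\<bar>Im (\<i> * \<tau> * sigma5_gf1_D \<tau>)\<bar> \<le> 189 / 50000 * (6860 * (1 / 366) + 66)"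
      using abs_Im_le_cmod [of "\<i> * \<tau> * sigma5_gf1_D \<tau>"] by (simp add: norm_mult)
    then have "\<mu> * \<bar>Im (\<i> * \<tau> * sigma5_gf1_D \<tau>)\<bar> \<le> 529 * (189 / 50000 * (6860 * (1 / 366) + 66))"
      by (rule mult_mono [rotated]) (use \<mu>_bounds in auto)
    also have "\<dots> \<le> 170" by simp
    finally have "\<mu> * \<bar>Im (\<i> * \<tau> * sigma5_gf1_D \<tau>)\<bar> \<le> 170" .
    moreover have "- (\<mu> * \<bar>Im (\<i> * \<tau> * sigma5_gf1_D \<tau>)\<bar>) \<le> \<mu> * Im (\<i> * \<tau> * sigma5_gf1_D \<tau>)"
      by (rule minus_mult_abs_le) (use \<mu>_bounds in simp)
    ultimately show ?thesis by linarith
  qed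
  have re: "Re (2 * of_real pi * \<i> * z) = - (2 * pi * Im z)" for z by simp
  have "Re ?G' = 2 * pi * (S + \<kappa> * Im (sigma5_gf_D \<tau>) + \<mu> * Im (\<i> * \<tau> * sigma5_gf1_D \<tau>)) + \<mu> * Im (sigma5_gf1 \<tau>)"
  proof -
    have "?G' = - (2 * of_real pi * \<i> * (1 / nome \<tau> + of_real \<kappa> * sigma5_gf_D \<tau> + of_real \<mu> * (\<i> * \<tau> * sigma5_gf1_D \<tau>)))
        - of_real \<mu> * (\<i> * sigma5_gf1 \<tau>)"
      by (simp add: algebra_simps)
    then have "Re ?G' = - Re (2 * of_real pi * \<i> * (1 / nome \<tau> + of_real \<kappa> * sigma5_gf_D \<tau> + of_real \<mu> * (\<i> * \<tau> * sigma5_gf1_D \<tau>)))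
        - Re (of_real \<mu> * (\<i> * sigma5_gf1 \<tau>))"
      by (metis minus_complex.sel(1) uminus_complex.sel(1))
    then show ?thesis
      unfolding re by (simp add: S_def)
  qed
  \<comment> \<open>The relation \<mu> = pi \<kappa> / 3 lets the common factor 2 pi be taken
    out.\<close>
  also have "\<mu> * Im (sigma5_gf1 \<tau>) = 2 * pi * (\<kappa> * Im (sigma5_gf1 \<tau>) / 6)" by (simp add: \<mu>_def)
  finally have "Re ?G' = 2 * pi * (S + \<kappa> * Im (sigma5_gf_D \<tau>) + \<mu> * Im (\<i> * \<tau> * sigma5_gf1_D \<tau>) + \<kappa> * Im (sigma5_gf1 \<tau>) / 6)"
    by (simp add: distrib_left)
  moreover have "0 < S + \<kappa> * Im (sigma5_gf_D \<tau>) + \<mu> * Im (\<i> * \<tau> * sigma5_gf1_D \<tau>) + \<kappa> * Im (sigma5_gf1 \<tau>) / 6"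
    using S a b d by linarith
  ultimately show "Re ?G' > 0"
    by (simp only: mult_pos_pos pi_gt_zero zero_less_mult_iff) simp
qed

text \<open>A holomorphic function whose derivative has positive real part is injective on convex sets.\<close>

lemma quasi_g3_zero_unique:
  assumes "w \<in> fund_triangle" "z \<in> fund_triangle" "quasi_g3 w = 0" "quasi_g3 z = 0"
  shows "w = z"
proof (rule ccontr)
  assume "w \<noteq> z"
  define Q where "Q = {\<tau>. Im \<tau> \<ge> 47 / 50} \<inter> {\<tau>. Re \<tau> \<ge> 5 / 8} \<inter> {\<tau>. Re \<tau> \<le> 7 / 8}"
  have cQ: "convex Q"
    unfolding Q_def by (intro convex_Int convex_halfspace_Im_ge convex_halfspace_Re_ge convex_halfspace_Re_le)
  have "\<tau> \<in> Q" if "\<tau> \<in> fund_triangle" "quasi_g3 \<tau> = 0" for \<tau>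
    using quasi_g3_zero_Im_ge [OF that] quasi_g3_zero_Re_bounds [OF quasi_g3_zero_Im_ge [OF that] fund_triangleD(2,3) [OF that(1)] that(2)]
    by (simp add: Q_def)
  then have seg: "closed_segment w z \<subseteq> Q"
    using assms cQ by (intro closed_segment_subset) auto
  have "\<exists>G'. (quasi_g3 has_field_derivative G') (at u) \<and> Re G' > 0" if "u \<in> Q" for u
    using quasi_g3_has_field_derivative [of u] that unfolding Q_def by blast
  then obtain G' where G': "\<And>u. u \<in> Q \<Longrightarrow> (quasi_g3 has_field_derivative G' u) (at u)" "\<And>u. u \<in> Q \<Longrightarrow> Re (G' u) > 0"
    by metis
  \<comment> \<open>Dividing by z - w cancels the increment in the mean value theorem, which then
    speaks of Re (G' u) itself.\<close>
  have "((\<lambda>u. quasi_g3 u / (z - w)) has_field_derivative G' u / (z - w)) (at u)" if "u \<in> closed_segment w z" for u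
    using G'(1) seg that by (intro DERIV_cdivide) auto
  from complex_mvt_line [OF this] obtain u where u: "u \<in> closed_segment w z"
    "Re (quasi_g3 z / (z - w)) - Re (quasi_g3 w / (z - w)) = Re (G' u / (z - w) * (z - w))"
    by blast
  then have "Re (G' u) = 0" using assms \<open>w \<noteq> z\<close> by simp
  with G'(2) u(1) seg show False by fastforce
qed

subsection \<open>Zeros of the derivative\<close>

lemma g3_DERIV_deriv: "Im \<tau> > 0 \<Longrightarrow> (g3 has_field_derivative deriv g3 \<tau>) (at \<tau>)"
  using g3_has_field_derivative [of \<tau>] deriv_g3 [of \<tau>] by simp

lemma deriv_g3_plus_int:
  assumes "Im \<tau> > 0"
  shows "deriv g3 (\<tau> + of_int m) = deriv g3 \<tau>"
  using deriv_g3 [OF assms] deriv_g3 [of "\<tau> + of_int m"] assms by (simp add: nome_add_int)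

text \<open>Differentiating the weight 6 law produces the extra term 6 g3. Hence g3' vanishes at
  -1/\<tau> exactly when 6 g3 + \<tau> g3' vanishes at \<tau>.\<close>

lemma deriv_g3_inversion:
  assumes "Im \<tau> > 0"
  shows "deriv g3 (- 1 / \<tau>) = \<tau> ^ 7 * (6 * g3 \<tau> + \<tau> * deriv g3 \<tau>)"
proof -
  have t: "\<tau> \<noteq> 0" using assms by auto
  have "Im (- 1 / \<tau>) = Im \<tau> / (norm \<tau>)\<^sup>2"
    by (simp add: Im_divide cmod_power2)
  then have "Im (- 1 / \<tau>) > 0" using assms t by simp
  then have "(g3 has_field_derivative deriv g3 (- 1 / \<tau>)) (at (- 1 / \<tau>))"
    by (rule g3_DERIV_deriv)
  moreover have "((\<lambda>\<tau>. - 1 / \<tau>) has_field_derivative 1 / \<tau>\<^sup>2) (at \<tau>)"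
    using t by (auto intro!: derivative_eq_intros simp: power2_eq_square)
  ultimately have 1: "((\<lambda>\<tau>. g3 (- 1 / \<tau>)) has_field_derivative deriv g3 (- 1 / \<tau>) * (1 / \<tau>\<^sup>2)) (at \<tau>)"
    by (rule DERIV_chain2)
  have "(g3 has_field_derivative deriv g3 \<tau>) (at \<tau>)"
    by (rule g3_DERIV_deriv [OF assms])
  then have "((\<lambda>\<tau>. \<tau> ^ 6 * g3 \<tau>) has_field_derivative 6 * \<tau> ^ 5 * g3 \<tau> + \<tau> ^ 6 * deriv g3 \<tau>) (at \<tau>)"
    by (auto intro!: derivative_eq_intros)
  then have 2: "((\<lambda>\<tau>. g3 (- 1 / \<tau>)) has_field_derivative 6 * \<tau> ^ 5 * g3 \<tau> + \<tau> ^ 6 * deriv g3 \<tau>) (at \<tau>)"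
  proof (rule has_field_derivative_transform_within_open)
    show "open (- {0 :: complex})" by (intro open_Compl closed_singleton)
  qed (use t g3_inversion in auto)
  from DERIV_unique [OF 1 2]
  have "deriv g3 (- 1 / \<tau>) = \<tau>\<^sup>2 * (6 * \<tau> ^ 5 * g3 \<tau> + \<tau> ^ 6 * deriv g3 \<tau>)"
    using t by (simp add: field_simps)
  then show ?thesis by (simp add: algebra_simps eval_nat_numeral)
qed

lemma deriv_g3_eq_0_iff: "Im \<tau> > 0 \<Longrightarrow> deriv g3 \<tau> = 0 \<longleftrightarrow> sigma5_gf1 \<tau> = 0"
  by (simp add: deriv_g3_eq_sigma5_gf1 nome_nonzero)

lemma sigma5_gf1_plus_int: "sigma5_gf1 (\<tau> + of_int m) = sigma5_gf1 \<tau>"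
  by (simp add: sigma5_gf1_def nome_add_int)

lemma sigma5_gf1_reflect: "Im \<tau> > 0 \<Longrightarrow> sigma5_gf1 (1 - cnj \<tau>) = cnj (sigma5_gf1 \<tau>)"
  using sigma5_gf1_plus_int [of "- cnj \<tau>" 1] by (simp add: cnj_sigma5_gf1)

text \<open>At this height |q| \<le> 1/230, and 66/230 + 2287/230^2 < 1 keeps the series within
  distance 1 of its constant term 1.\<close>

lemma Re_sigma5_gf1_pos:
  assumes "sqrt 3 / 2 \<le> Im \<tau>"
  shows "Re (sigma5_gf1 \<tau>) > 0"
proof -
  note q = norm_nome_le_230 [OF assms]
  then have "norm (nome \<tau>) ^ 2 \<le> (1 / 230) ^ 2" by (intro power_mono) auto
  then have "2287 * norm (nome \<tau>) ^ 2 + 66 * norm (nome \<tau>) < 1" using q by (simp add: power2_eq_square)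
  moreover have "norm (sigma5_gf1 \<tau> - 1) \<le> norm (sigma5_gf1 \<tau> - (1 + 66 * nome \<tau>)) + norm (66 * nome \<tau>)"
    using norm_triangle_ineq [of "sigma5_gf1 \<tau> - (1 + 66 * nome \<tau>)" "66 * nome \<tau>"] by simp
  moreover have "norm (66 * nome \<tau>) = 66 * norm (nome \<tau>)" by (simp add: norm_mult)
  ultimately have "norm (sigma5_gf1 \<tau> - 1) < 1" using sigma5_gf1_bound [OF q] by linarith
  then show ?thesis using abs_Re_le_cmod [of "sigma5_gf1 \<tau> - 1"] by simp
qed

lemma deriv_g3_nonzero_fund_triangle: "\<tau> \<in> fund_triangle \<Longrightarrow> deriv g3 \<tau> \<noteq> 0"
  using Re_sigma5_gf1_pos [OF fund_triangle_Im_ge] fund_triangleD(1) by (force simp: deriv_g3_eq_0_iff)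

text \<open>The right half of the ideal triangle \<open>F0\<close> is the part of \<open>fund_triangle\<close> with real part at
  least \<open>1/2\<close> together with the image of \<open>fund_triangle\<close> under \<open>w \<mapsto> 1 - 1/w\<close>, which turns \<open>F0\<close> about
  its centre and sends the cusp \<open>\<infinity>\<close> to \<open>1\<close>.\<close>

lemma deriv_g3_zero_in_right_half:
  assumes "\<tau> \<in> F0" "deriv g3 \<tau> = 0" "1 / 2 \<le> Re \<tau>"
  shows "1 / (1 - \<tau>) \<in> fund_triangle \<and> quasi_g3 (1 / (1 - \<tau>)) = 0"
proof -
  define x y where "x = Re \<tau>" and "y = Im \<tau>"
  have y: "0 < y" and x: "1 / 2 \<le> x" "x \<le> 1" and c: "1 / 2 \<le> cmod (\<tau> - 1 / 2)"
    using assms by (auto simp: F0_def upper_half_plane_def x_def y_def)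
  have "(1 / 2)\<^sup>2 \<le> (cmod (\<tau> - 1 / 2))\<^sup>2" using c by (intro power_mono) auto
  then have tri: "x \<le> x\<^sup>2 + y\<^sup>2"
    unfolding cmod_power2 by (simp add: x_def y_def power2_eq_square algebra_simps)
  \<comment> \<open>As Re \<tau> \<ge> 1/2, the point \<tau> is at least as far from 0 as from 1.
    Outside the unit circle about 1 it would lie in \<open>fund_triangle\<close>, where g3' has no
    zero.\<close>
  have out: "cmod (\<tau> - 1) \<le> 1"
  proof (rule ccontr)
    assume *: "\<not> cmod (\<tau> - 1) \<le> 1"
    then have "1\<^sup>2 \<le> (cmod (\<tau> - 1))\<^sup>2" by (intro power_mono) auto
    then have "1 \<le> (cmod \<tau>)\<^sup>2"
      using x unfolding cmod_power2 by (simp add: x_def y_def power2_eq_square algebra_simps)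
    then have "1 \<le> cmod \<tau>" by (simp add: abs_le_square_iff [of 1, simplified, symmetric] power2_le_imp_le [of 1])
    with * have "\<tau> \<in> fund_triangle" using x y by (simp add: fund_triangle_def x_def y_def)
    then show False using deriv_g3_nonzero_fund_triangle assms(2) by blast
  qed
  \<comment> \<open>The inverse of w -> 1 - 1/w; thus -1/w = \<tau> - 1, where g3' takes the same
    value as at \<tau>.\<close>
  define w where "w = 1 / (1 - \<tau>)"
  have t1: "1 - \<tau> \<noteq> 0" using y by (auto simp: y_def complex_eq_iff)
  define D where "D = (1 - x)\<^sup>2 + y\<^sup>2"
  have D: "0 < D" using y by (simp add: D_def add_nonneg_pos)
  have w: "Re w = (1 - x) / D" "Im w = y / D"
    by (simp_all add: w_def Re_divide Im_divide D_def x_def y_def)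
  have nw: "cmod w = 1 / cmod (\<tau> - 1)" by (simp add: w_def norm_divide norm_minus_commute)
  have wm: "w - 1 = \<tau> * w" using t1 by (simp add: w_def field_simps)
  have "w \<in> fund_triangle"
  proof -
    have "Im w > 0" "0 \<le> Re w" using w D y x by auto
    \<comment> \<open>This is equivalent to |\<tau> - 1/2| \<ge> 1/2, in the form
      \<open>tri\<close>.\<close>
    moreover have "Re w \<le> 1"
      using D tri by (simp add: w divide_le_eq) (simp add: D_def power2_eq_square algebra_simps)
    moreover have "1 \<le> cmod w"
      using out t1 by (simp add: nw le_divide_eq)
    moreover have "1 \<le> cmod (w - 1)"
    proof -
      have "(cmod (\<tau> - 1))\<^sup>2 \<le> (cmod \<tau>)\<^sup>2"
        using x unfolding cmod_power2 by (simp add: x_def y_def power2_eq_square algebra_simps)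
      then have "cmod (\<tau> - 1) \<le> cmod \<tau>" by (rule power2_le_imp_le) simp
      then show ?thesis using t1 by (simp add: wm norm_mult nw le_divide_eq)
    qed
    ultimately show ?thesis by (simp add: fund_triangle_def)
  qed
  moreover have "quasi_g3 w = 0"
  proof -
    have imw: "Im w > 0" using \<open>w \<in> fund_triangle\<close> by (simp add: fund_triangle_def)
    have w0: "w \<noteq> 0" using imw by auto
    have tw: "- 1 / w = \<tau> + of_int (- 1)" using t1 by (simp add: w_def field_simps)
    have "deriv g3 (- 1 / w) = 0"
      unfolding tw using deriv_g3_plus_int [of \<tau> "- 1"] y assms(2) by (simp add: y_def)
    then have "6 * g3 w + w * deriv g3 w = 0"
      using deriv_g3_inversion [OF imw] w0 by simp
    then show "quasi_g3 w = 0"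
      using weight_6_derivative_eq_quasi_g3 [OF imw] nome_nonzero [of w] zeta6_bounds by auto
  qed
  ultimately show ?thesis by (simp add: w_def)
qed

lemma deriv_g3_zero_unique_right_half:
  assumes "\<tau> \<in> F0" "deriv g3 \<tau> = 0" "1 / 2 \<le> Re \<tau>"
    and "\<sigma> \<in> F0" "deriv g3 \<sigma> = 0" "1 / 2 \<le> Re \<sigma>"
  shows "\<tau> = \<sigma>"
proof -
  have "1 / (1 - \<tau>) = 1 / (1 - \<sigma>)"
    using deriv_g3_zero_in_right_half assms quasi_g3_zero_unique by blast
  then show ?thesis by (simp add: divide_inverse)
qed

lemma F0_reflect: "\<tau> \<in> F0 \<Longrightarrow> 1 - cnj \<tau> \<in> F0"
proof -
  have "cmod (1 - cnj \<tau> - 1 / 2) = cmod (\<tau> - 1 / 2)"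
    by (simp add: cmod_def power2_commute)
  then show "\<tau> \<in> F0 \<Longrightarrow> 1 - cnj \<tau> \<in> F0"
    by (auto simp: F0_def upper_half_plane_def)
qed

section \<open>A zero on the line of real part 1/2\<close>

text \<open>The inversion fixes i, and i^6 = -1 forces g3 to vanish there; it carries (1 + i)/2 to i
  - 1, an integer translate of i.\<close>

lemma g3_zero_half_plus_half_i: "g3 (1 / 2 + \<i> / 2) = 0"
proof -
  let ?t = "1 / 2 + \<i> / 2 :: complex"
  have t: "?t \<noteq> 0" by (simp add: complex_eq_iff)
  have i6: "\<i> ^ 6 = (-1 :: complex)" by (simp add: eval_nat_numeral)
  have "- 1 / \<i> = \<i>" by simp
  then have "g3 \<i> = - g3 \<i>" using g3_inversion [of \<i>] i6 by simp
  then have "g3 \<i> = 0" by simp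
  moreover have "- 1 / ?t = \<i> + of_int (- 1)" by (simp add: complex_eq_iff Re_divide Im_divide power2_eq_square)
  ultimately have "g3 (- 1 / ?t) = 0" using g3_plus_int [of \<i> "- 1"] by simp
  then show ?thesis using g3_inversion [OF t] t by simp
qed

lemma nome_half: "nome (1 / 2 + \<i> * of_real b) = of_real (- exp (- (2 * pi * b)))"
  by (rule complex_eqI) (simp_all add: Re_nome Im_nome norm_nome)

text \<open>The reflection \<open>\<tau> \<mapsto> 1 - cnj \<tau>\<close> fixes the line Re \<tau> =
  1/2 pointwise.\<close>

lemma sigma5_gf1_half_real:
  assumes "b > 0"
  shows "Im (sigma5_gf1 (1 / 2 + \<i> * of_real b)) = 0"
proof -
  have "1 - cnj (1 / 2 + \<i> * of_real b) = 1 / 2 + \<i> * of_real b" by (simp add: complex_eq_iff)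
  then have "cnj (sigma5_gf1 (1 / 2 + \<i> * of_real b)) = sigma5_gf1 (1 / 2 + \<i> * of_real b)"
    using sigma5_gf1_reflect [of "1 / 2 + \<i> * of_real b"] assms by simp
  then show ?thesis by (simp add: complex_eq_iff)
qed

text \<open>Along the line d/db is i d/d\<tau>, and q = -exp (-2 pi b) is negative. So the
  derivative and the real part of \<open>sigma5_gf1\<close> have opposite signs.\<close>

lemma Re_g3_half_has_real_derivative:
  assumes "b > 0"
  shows "((\<lambda>b. Re (g3 (1 / 2 + \<i> * of_real b))) has_real_derivative
      - (896 * pi ^ 7 / 3 * exp (- (2 * pi * b)) * Re (sigma5_gf1 (1 / 2 + \<i> * of_real b)))) (at b)"
proof -
  let ?t = "1 / 2 + \<i> * of_real b"
  have im: "Im ?t > 0" using assms by simp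
  have "(g3 has_field_derivative deriv g3 ?t) (at ?t)"
    by (rule g3_DERIV_deriv [OF im])
  moreover have "((\<lambda>b. 1 / 2 + \<i> * of_real b) has_vector_derivative \<i>) (at b)"
    by (auto intro!: derivative_eq_intros simp: has_vector_derivative_def scaleR_conv_of_real)
  ultimately have "(g3 \<circ> (\<lambda>b. 1 / 2 + \<i> * of_real b) has_vector_derivative \<i> * deriv g3 ?t) (at b)"
    using field_vector_diff_chain_at by blast
  then have "((\<lambda>b. Re (g3 (1 / 2 + \<i> * of_real b))) has_real_derivative Re (\<i> * deriv g3 ?t)) (at b)"
    unfolding has_real_derivative_iff_has_vector_derivative o_def
    by (rule bounded_linear.has_vector_derivative [OF bounded_linear_Re])
  moreover have "Re (\<i> * deriv g3 ?t) = - (896 * pi ^ 7 / 3 * exp (- (2 * pi * b)) * Re (sigma5_gf1 ?t))"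
  proof -
    have c: "896 * of_real pi ^ 7 / 3 = (of_real (896 * pi ^ 7 / 3) :: complex)" by simp
    have "\<i> * deriv g3 ?t = of_real (- (896 * pi ^ 7 / 3 * exp (- (2 * pi * b)))) * sigma5_gf1 ?t"
      unfolding deriv_g3_eq_sigma5_gf1 [OF im] nome_half c by (simp add: algebra_simps)
    then show ?thesis by simp
  qed
  ultimately show ?thesis by (simp only:)
qed

lemma deriv_g3_zero_exists:
  obtains b where "1 / 2 < b" "b < sqrt 3 / 2" "deriv g3 (1 / 2 + \<i> * of_real b) = 0"
proof -
  define l where "l = (\<lambda>b. 1 / 2 + \<i> * of_real b)"
  let ?s = "sqrt 3 / 2"
  have s: "1 / 2 < ?s" by simp
  have ims: "Im (l ?s) = ?s" by (simp add: l_def)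
  have ims': "Im (l ?s) > 0" unfolding ims by simp
  have n: "nome (l ?s) = of_real (- exp (- (2 * pi * ?s)))"
    unfolding l_def by (rule nome_half)
  have "Re (g3 (l (1 / 2))) = 0" using g3_zero_half_plus_half_i by (simp add: l_def)
  moreover have "Re (g3 (l ?s)) > 0"
  proof -
    note q = norm_nome_le_230 [of "l ?s", unfolded ims, OF order_refl]
    then have "norm (nome (l ?s)) ^ 2 \<le> (1 / 230) ^ 2" by (intro power_mono) auto
    then have "763 * norm (nome (l ?s)) ^ 2 + 33 * norm (nome (l ?s)) < 1" using q by (simp add: power2_eq_square)
    moreover have "norm (sigma5_gf (l ?s) - 1) \<le> norm (sigma5_gf (l ?s) - (1 + 33 * nome (l ?s))) + norm (33 * nome (l ?s))"
      using norm_triangle_ineq [of "sigma5_gf (l ?s) - (1 + 33 * nome (l ?s))" "33 * nome (l ?s)"] by simp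
    moreover have "norm (33 * nome (l ?s)) = 33 * norm (nome (l ?s))" by (simp add: norm_mult)
    ultimately have "norm (sigma5_gf (l ?s) - 1) < 1" using sigma5_gf_bound [OF q] by linarith
    then have "Re (sigma5_gf (l ?s)) > 0" using abs_Re_le_cmod [of "sigma5_gf (l ?s) - 1"] by simp
    \<comment> \<open>The negative sign of q on this line turns the minus of the expansion into a
      plus, and both summands are positive.\<close>
    moreover have "Re (g3 (l ?s)) = 280 * (zeta6 + 8 * pi ^ 6 / 15 * exp (- (2 * pi * ?s)) * Re (sigma5_gf (l ?s)))"
    proof -
      have c: "8 * of_real pi ^ 6 / 15 = (of_real (8 * pi ^ 6 / 15) :: complex)" by simp
      have "g3 (l ?s) = of_real 280 * (of_real zeta6 + of_real (8 * pi ^ 6 / 15 * exp (- (2 * pi * ?s))) * sigma5_gf (l ?s))"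
        unfolding g3_eq_sigma5_gf [OF ims'] c n by simp
      then show ?thesis by simp
    qed
    ultimately show ?thesis using zeta6_bounds by (simp add: add_pos_pos)
  qed
  moreover
  define K' where "K' = (\<lambda>b. - (896 * pi ^ 7 / 3 * exp (- (2 * pi * b)) * Re (sigma5_gf1 (l b))))"
  have K': "((\<lambda>b. Re (g3 (l b))) has_real_derivative K' b) (at b)" if "b > 0" for b
    using Re_g3_half_has_real_derivative [OF that] by (simp add: l_def K'_def)
  \<comment> \<open>Re g3 rises from 0 at b = 1/2 to a positive value at b = sqrt 3 / 2, so its
    derivative is positive somewhere in between. There \<open>sigma5_gf1\<close> is negative, while
    at the upper end it is positive.\<close>
  obtain \<xi> where \<xi>: "1 / 2 < \<xi>" "\<xi> < ?s" "Re (g3 (l ?s)) - Re (g3 (l (1 / 2))) = (?s - 1 / 2) * K' \<xi>"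
    using MVT2 [OF s, of "\<lambda>b. Re (g3 (l b))" K'] K' by force
  ultimately have "(?s - 1 / 2) * K' \<xi> > 0" by simp
  then have "K' \<xi> > 0" using s by (simp add: zero_less_mult_iff)
  then have 1: "Re (sigma5_gf1 (l \<xi>)) < 0" by (simp add: K'_def mult_less_0_iff)
  have 2: "Re (sigma5_gf1 (l ?s)) > 0" using Re_sigma5_gf1_pos [of "l ?s"] by (simp add: ims)
  have "\<exists>b. \<xi> \<le> b \<and> b \<le> ?s \<and> Re (sigma5_gf1 (l b)) = 0"
  proof (rule IVT)
    show "\<forall>b. \<xi> \<le> b \<and> b \<le> ?s \<longrightarrow> isCont (\<lambda>b. Re (sigma5_gf1 (l b))) b"
    proof (intro allI impI)
      fix b assume "\<xi> \<le> b \<and> b \<le> ?s"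
      then have "isCont sigma5_gf1 (l b)"
        using \<xi> by (intro DERIV_isCont [OF sigma5_gf1_has_field_derivative]) (simp add: l_def)
      then have "isCont (\<lambda>b. sigma5_gf1 (l b)) b"
        unfolding l_def by (intro isCont_o2 [of _ "\<lambda>b. 1 / 2 + \<i> * of_real b" sigma5_gf1]) (auto intro!: continuous_intros)
      then show "isCont (\<lambda>b. Re (sigma5_gf1 (l b))) b" by (rule isCont_Re)
    qed
  qed (use 1 2 \<xi> in auto)
  then obtain b where b: "\<xi> \<le> b" "b \<le> ?s" "Re (sigma5_gf1 (l b)) = 0" by blast
  then have "sigma5_gf1 (l b) = 0" using sigma5_gf1_half_real [of b] \<xi> by (simp add: complex_eq_iff l_def)
  then have "deriv g3 (l b) = 0" using b \<xi> by (simp add: deriv_g3_eq_0_iff l_def)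
  moreover have "b \<noteq> ?s"
  proof
    assume "b = ?s"
    then have "Re (sigma5_gf1 (l ?s)) = 0" using b(3) by (simp only:)
    with 2 show False by simp
  qed
  ultimately show ?thesis using that [of b] b \<xi> by (simp add: l_def)
qed

theorem theorem2p1:
  shows "\<exists>\<tau>_inf :: complex.
           {\<tau> \<in> F0. deriv g3 \<tau> = 0} = {\<tau>_inf}
         \<and> (\<exists>b_inf :: real. 1/2 < b_inf \<and> b_inf < sqrt 3 / 2 \<and>
               \<tau>_inf = 1/2 + \<i> * of_real b_inf)
         \<and> (\<forall>m :: int. {\<tau> \<in> (\<lambda>z. z + of_int m) ` F0. deriv g3 \<tau> = 0} = {\<tau>_inf + of_int m})"
proof -
  obtain b where b: "1 / 2 < b" "b < sqrt 3 / 2" "deriv g3 (1 / 2 + \<i> * of_real b) = 0"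
    by (rule deriv_g3_zero_exists)
  define t where "t = 1 / 2 + \<i> * of_real b"
  have t: "t \<in> F0" "deriv g3 t = 0" "Re t = 1 / 2"
    using b by (auto simp: t_def F0_def upper_half_plane_def norm_mult)
  have uniq: "\<tau> = t" if "\<tau> \<in> F0" "deriv g3 \<tau> = 0" for \<tau>
  proof (cases "1 / 2 \<le> Re \<tau>")
    case True
    then show ?thesis using deriv_g3_zero_unique_right_half that t by simp
  next
    case False
    have im: "Im \<tau> > 0" using that by (simp add: F0_def upper_half_plane_def)
    \<comment> \<open>The reflected zero lies in the right half and hence equals t. Then Re \<tau> =
      1/2, against Re \<tau> < 1/2.\<close>
    have "deriv g3 (1 - cnj \<tau>) = 0"
      using that im by (simp add: deriv_g3_eq_0_iff sigma5_gf1_reflect)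
    then have "1 - cnj \<tau> = t"
      using deriv_g3_zero_unique_right_half [of "1 - cnj \<tau>" t] F0_reflect [OF that(1)] False t by simp
    then have "Re (1 - cnj \<tau>) = Re t" by simp
    with False t(3) show ?thesis by simp
  qed
  have eq: "{\<tau> \<in> F0. deriv g3 \<tau> = 0} = {t}" using uniq t(1,2) by blast
  have "{\<tau> \<in> (\<lambda>z. z + of_int m) ` F0. deriv g3 \<tau> = 0} = {t + of_int m}" for m :: int
  proof -
    have "deriv g3 (z + of_int m) = deriv g3 z" if "z \<in> F0" for z
      using that by (intro deriv_g3_plus_int) (simp add: F0_def upper_half_plane_def)
    then have "{\<tau> \<in> (\<lambda>z. z + of_int m) ` F0. deriv g3 \<tau> = 0} = (\<lambda>z. z + of_int m) ` {\<tau> \<in> F0. deriv g3 \<tau> = 0}"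
      by auto
    then show ?thesis by (simp add: eq)
  qed
  with eq b show ?thesis by (intro exI [of _ t]) (auto simp: t_def)
qed

end
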